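(* Let $d\ge1$ be an integer, let $\mu\in[0,1]$, and let $\boldsymbol{M}=(M_1,\dots,M_d)$. If $\mathcal{F}(\boldsymbol{M})$ is nonempty, then there exists a unique optimal solution $\bar F$ of the minimization of $D_{\min}(\cdot,\mu)$ over $\mathcal{F}(\boldsymbol{M})$, that is, a unique $\bar F\in\mathcal{F}(\boldsymbol{M})$ such that $$D_{\min}^{(d)}(\boldsymbol{M},\mu)=\inf_{F\in\mathcal{F}(\boldsymbol{M})}D_{\min}(F,\mu)=D_{\min}(\bar F,\mu).$$ Furthermore, put $l=\lceil d/2\rceil+1$ and $M_0=1$. A distribution $F\in\mathcal{F}$ is the unique optimal solution $\bar F$ if and only if $F=\sum_{i=1}^{l} f_i\,\delta(x_i)$ for some points $0\le x_1<\dots<x_l\le 1$ and weights $f_1,\dots,f_l\ge 0$ satisfying - if $d$ is odd: $\sum_{i=1}^{l} f_i x_i^m=M_m$ for $m=0,1,\dots,d$, with $x_1=0$ and $x_l=1$; - if $d$ is even: $\sum_{i=1}^{l} f_i x_i^m=M_m$ for $m=0,1,\dots,d$, with $x_l=1$.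
   Context: $\mathcal{F}$ is the family of all probability distributions on $[0,1]$, and $\mathrm{E}_F[\cdot]$ denotes expectation when $X$ has distribution $F$. The Kullback-Leibler divergence is $D(F\Vert G)=\mathrm{E}_F[\log \frac{\mathrm{d}F}{\mathrm{d}G}]$ if the density $\frac{\mathrm{d}F}{\mathrm{d}G}$ exists, and $D(F\Vert G)=+\infty$ otherwise. For $F\in\mathcal{F}$ and $\mu\in[0,1]$, $$D_{\min}(F,\mu)=\min_{G\in\mathcal{F}:\,\mathrm{E}_G[X]\ge\mu} D(F\Vert G).$$ For $\boldsymbol{M}=(M_1,\dots,M_d)$ let $\mathcal{F}(\boldsymbol{M})=\{F\in\mathcal{F}:(\mathrm{E}_F[X],\dots,\mathrm{E}_F[X^d])=\boldsymbol{M}\}$ and $D_{\min}^{(d)}(\boldsymbol{M},\mu)=\inf_{F\in\mathcal{F}(\boldsymbol{M})}D_{\min}(F,\mu)$. $\delta(x)$ is the unit point mass at $x$. The convention $0^0=1$ is used. Weights $f_i$ are allowed to be zero.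
   Formalization: Uniqueness of the optimal solution is claimed only for M_1 < μ < 1, since for μ ≤ M_1 or μ = 1 every F in F(M) is optimal (e.g. d=1, M_1=1/2, μ=0); for all μ in [0,1], the distribution of the stated form exists, is unique and is optimal. *)

theory Defs
  imports "HOL-Probability.Probability"
begin

text \<open>Distributions on $[0,1]$ are represented as Borel distributions on the real line that are
  concentrated on $[0,1]$.\<close>

definition unit_distributions :: "real measure set" where
  "unit_distributions = {F. real_distribution F \<and> (AE x in F. x \<in> {0..1})}"

text \<open>\<^const>\<open>KL_divergence\<close> is real valued, takes the reference measure first, and silently
  returns 0 when the log-density is not integrable. The negative part of $\log (dF/dG)$ is always
  $F$-integrable for probability measures, so in that case the expectation is $+\infty$.\<close>

definition KL :: "real measure \<Rightarrow> real measure \<Rightarrow> ereal" where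
  "KL F G =
    (if absolutely_continuous G F \<and> integrable F (entropy_density (exp 1) G F)
     then ereal (KL_divergence (exp 1) G F) else \<infinity>)"

definition D_min :: "real measure \<Rightarrow> real \<Rightarrow> ereal" where
  "D_min F \<mu> = (INF G \<in> {G \<in> unit_distributions. (\<integral>x. x \<partial>G) \<ge> \<mu>}. KL F G)"

text \<open>Only the entries $M_1, \ldots, M_d$ of a moment sequence are relevant.\<close>

definition moment_class :: "nat \<Rightarrow> (nat \<Rightarrow> real) \<Rightarrow> real measure set" where
  "moment_class d M =
    {F \<in> unit_distributions. \<forall>m \<in> {1..d}. (\<integral>x. x ^ m \<partial>F) = M m}"

definition D_min_moments :: "nat \<Rightarrow> (nat \<Rightarrow> real) \<Rightarrow> real \<Rightarrow> ereal" where
  "D_min_moments d M \<mu> = (INF F \<in> moment_class d M. D_min F \<mu>)"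

definition optimal_solution :: "nat \<Rightarrow> (nat \<Rightarrow> real) \<Rightarrow> real \<Rightarrow> real measure \<Rightarrow> bool" where
  "optimal_solution d M \<mu> F \<longleftrightarrow>
    F \<in> moment_class d M \<and> D_min_moments d M \<mu> = D_min F \<mu>"

text \<open>The measure $\sum_{i=1}^{l} f_i \delta(x_i)$.\<close>

definition point_mixture :: "nat \<Rightarrow> (nat \<Rightarrow> real) \<Rightarrow> (nat \<Rightarrow> real) \<Rightarrow> real measure" where
  "point_mixture l f x =
    measure_of UNIV (sets borel)
      (\<lambda>A. \<Sum>i = 1..l. ennreal (f i) * emeasure (return borel (x i)) A)"

lemma sets_point_mixture [simp]: "sets (point_mixture l f x) = sets borel"
  unfolding point_mixture_def
  by (metis sets.sets_measure_of_eq space_borel)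

lemma emeasure_point_mixture:
  assumes "A \<in> sets borel"
  shows "emeasure (point_mixture l f x) A =
    (\<Sum>i = 1..l. ennreal (f i) * emeasure (return borel (x i)) A)"
proof (rule emeasure_measure_of[OF point_mixture_def])
  show "sets borel \<subseteq> Pow (UNIV :: real set)" by simp
  show "A \<in> sets (point_mixture l f x)" using assms by simp
  show "positive (sets (point_mixture l f x))
     (\<lambda>A. \<Sum>i = 1..l. ennreal (f i) * emeasure (return borel (x i)) A)"
    by (simp add: positive_def)
  show "countably_additive (sets (point_mixture l f x))
     (\<lambda>A. \<Sum>i = 1..l. ennreal (f i) * emeasure (return borel (x i)) A)"
    unfolding sets_point_mixture
  proof (rule countably_additiveI)
    fix B :: "nat \<Rightarrow> real set"
    assume B: "range B \<subseteq> sets borel" "disjoint_family B" "(\<Union>i. B i) \<in> sets borel"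
    have "(\<Sum>n. emeasure (return borel (x i)) (B n)) = emeasure (return borel (x i)) (\<Union>n. B n)"
      for i
      by (rule suminf_emeasure) (use B in auto)
    then show "(\<Sum>n. \<Sum>i = 1..l. ennreal (f i) * emeasure (return borel (x i)) (B n)) =
      (\<Sum>i = 1..l. ennreal (f i) * emeasure (return borel (x i)) (\<Union>n. B n))"
      by (subst suminf_sum) auto
  qed
qed

definition num_points :: "nat \<Rightarrow> nat" where
  "num_points d = nat \<lceil>real d / 2\<rceil> + 1"

text \<open>The update \<open>M(0 := 1)\<close> is the convention $M_0 = 1$.\<close>

definition moment_representation ::
  "nat \<Rightarrow> (nat \<Rightarrow> real) \<Rightarrow> (nat \<Rightarrow> real) \<Rightarrow> (nat \<Rightarrow> real) \<Rightarrow> bool" where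
  "moment_representation d M f x \<longleftrightarrow>
    (let l = num_points d in
      0 \<le> x 1 \<and> strict_mono_on {1..l} x \<and> x l \<le> 1 \<and>
      (\<forall>i \<in> {1..l}. 0 \<le> f i) \<and>
      (\<forall>m \<in> {0..d}. (\<Sum>i = 1..l. f i * x i ^ m) = (M(0 := 1)) m) \<and>
      (odd d \<longrightarrow> x 1 = 0 \<and> x l = 1) \<and>
      (even d \<longrightarrow> x l = 1))"

end

theory Submission
  imports Defs
begin

text \<open>
  The optimal distribution $\bar F$ is the upper principal representation of the moment sequence.
  It arises by Gauss quadrature with prescribed endpoints. Let $R$ be the monic polynomial
  of degree $d + 1$ that vanishes at the nodes, doubly except at the prescribed endpoints, so that
  $R \le 0$ on $[0,1]$. Since the nodes are nonnegative, the quotient of $x^k$ by $R$ has nonnegative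
  coefficients, hence $\bar F$ maximises every moment $E[X^k]$ over the moment class, and strictly so
  for $k = d + 1$. Expanding the logarithm into a power series, $\bar F$ is the unique minimiser of
  $E_F[\log (1 - \nu (X - \mu))]$ for every multiplier $0 < \nu < 1 / (1 - \mu)$.

  By weak duality this expectation is a lower bound for $D_{\min}(F, \mu)$. If $\bar F$ has
  positive mass at 1, some $\nu$ makes $d\bar F / (1 - \nu (x - \mu))$ a probability
  distribution with mean $\mu$, and the bound is attained for $\bar F$. If $\bar F$ has no mass at
  1, then $R / (x - 1)$ has degree $d$ and expectation zero, which forces the moment class to be a
  singleton.
\<close>

subsection \<open>Polynomials on the unit interval\<close>

text \<open>The quotient coefficients are the intermediate values of Horner's scheme: values at
  \<open>t\<close> of the tails of \<open>p\<close>, whose coefficients are again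
  nonnegative.\<close>

lemma synthetic_div_coeff_nonneg:
  fixes p :: "real poly"
  assumes "\<And>i. 0 \<le> coeff p i" and "0 \<le> t"
  shows "0 \<le> coeff (synthetic_div p t) i"
  using assms
proof (induction p arbitrary: i)
  case 0
  then show ?case by simp
next
  case (pCons a p)
  have nn: "0 \<le> coeff p i" for i
    using pCons.prems(1)[of "Suc i"] by simp
  have "0 \<le> poly p t"
    using nn \<open>0 \<le> t\<close> by (auto simp: poly_altdef intro!: sum_nonneg)
  then show ?case
    using pCons.IH[OF nn \<open>0 \<le> t\<close>] by (auto simp: coeff_pCons split: nat.split)
qed

text \<open>For a monomial, the coefficients of the quotient are complete homogeneous symmetric polynomials in the
  roots of the divisor, hence nonnegative.\<close>

lemma division_by_nonneg_roots:
  fixes g :: "real poly"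
  assumes "\<And>i. 0 \<le> coeff g i" and "\<And>t. t \<in> set ts \<Longrightarrow> 0 \<le> t"
  shows "\<exists>q r. g = (\<Prod>t\<leftarrow>ts. [:-t, 1:]) * q + r \<and> (\<forall>i. 0 \<le> coeff q i) \<and>
    (r = 0 \<or> degree r < length ts)"
  using assms(2)
proof (induction ts)
  case Nil
  show ?case by (rule exI[of _ g], rule exI[of _ 0]) (simp add: assms(1))
next
  case (Cons t ts)
  let ?R = "\<Prod>t\<leftarrow>ts. [:-t, 1:]"
  obtain q r where qr: "g = ?R * q + r" "\<And>i. 0 \<le> coeff q i" "r = 0 \<or> degree r < length ts"
    using Cons by auto
  have degR: "degree ?R \<le> length ts"
  proof (induction ts)
    case (Cons t ts)
    show ?case
      using degree_mult_le[of "[:-t, 1:]" "\<Prod>t\<leftarrow>ts. [:-t, 1:]"] Cons.IH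
      by (simp del: mult_pCons_left)
  qed simp
  \<comment> \<open>Dividing \<open>q\<close> once more by \<open>X - t\<close> leaves the constant
    \<open>poly q t\<close>; multiplied by \<open>?R\<close> it has degree at most
    \<open>length ts\<close> and joins the remainder.\<close>
  define r' where "r' = smult (poly q t) ?R + r"
  have "q = [:-t, 1:] * synthetic_div q t + [:poly q t:]"
    by (rule synthetic_div_correct'[symmetric])
  then have "g = ?R * ([:-t, 1:] * synthetic_div q t + [:poly q t:]) + r"
    using qr(1) by metis
  also have "\<dots> = (\<Prod>t\<leftarrow>t # ts. [:-t, 1:]) * synthetic_div q t + r'"
    by (simp only: list.map prod_list.Cons r'_def) (simp add: algebra_simps)
  finally have "g = (\<Prod>t\<leftarrow>t # ts. [:-t, 1:]) * synthetic_div q t + r'" .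
  moreover have "\<forall>i. 0 \<le> coeff (synthetic_div q t) i"
    using qr(2) Cons.prems by (auto intro!: synthetic_div_coeff_nonneg)
  moreover have "degree r' < length (t # ts)"
  proof -
    have "degree (smult (poly q t) ?R) \<le> length ts"
      using degR degree_smult_le order.trans by blast
    moreover have "degree r \<le> length ts"
      using qr(3) by auto
    ultimately show ?thesis
      unfolding r'_def by (simp add: degree_add_le le_imp_less_Suc)
  qed
  ultimately show ?case by blast
qed

lemma poly_no_root_sign:
  fixes p :: "real poly"
  assumes "\<And>x. 0 < x \<Longrightarrow> x < 1 \<Longrightarrow> poly p x \<noteq> 0"
  shows "(\<forall>x\<in>{0..1}. 0 \<le> poly p x) \<or> (\<forall>x\<in>{0..1}. poly p x \<le> 0)"
proof (rule ccontr)
  assume "\<not> ?thesis"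
  then obtain x y where xy: "x \<in> {0..1}" "y \<in> {0..1}" "poly p x < 0" "0 < poly p y"
    by (auto simp: not_le)
  then have "x \<noteq> y" by auto
  then consider "x < y" | "y < x" by linarith
  then show False
  proof cases
    case 1
    then obtain z where "x < z" "z < y" "poly p z = 0"
      using poly_IVT_pos[OF 1, of p] xy by auto
    then show False using assms[of z] xy by auto
  next
    case 2
    then obtain z where "y < z" "z < x" "poly p z = 0"
      using poly_IVT_neg[OF 2, of p] xy by auto
    then show False using assms[of z] xy by auto
  qed
qed

text \<open>The set \<open>S\<close> consists of the roots of odd order in the open unit interval.\<close>

lemma poly_sign_changes:
  fixes p :: "real poly"
  assumes "p \<noteq> 0"
  shows "\<exists>S. finite S \<and> S \<subseteq> {0<..<1} \<and> (\<forall>t\<in>S. poly p t = 0) \<and>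
    ((\<forall>x\<in>{0..1}. 0 \<le> poly (p * (\<Prod>t\<in>S. [:-t, 1:])) x) \<or>
     (\<forall>x\<in>{0..1}. poly (p * (\<Prod>t\<in>S. [:-t, 1:])) x \<le> 0))"
  using assms
proof (induction "degree p" arbitrary: p rule: less_induct)
  case less
  show ?case
  proof (cases "\<exists>t. 0 < t \<and> t < 1 \<and> poly p t = 0")
    case False
    then show ?thesis
      using poly_no_root_sign[of p] by (intro exI[of _ "{}"]) auto
  next
    case True
    then obtain t where t: "0 < t" "t < 1" "poly p t = 0" by blast
    then obtain s where s: "p = [:-t, 1:] * s"
      by (metis dvdE poly_eq_0_iff_dvd)
    with less.prems have "s \<noteq> 0" by auto
    then have "degree s < degree p"
      unfolding s by (subst degree_mult_eq) auto
    from less.hyps[OF this \<open>s \<noteq> 0\<close>] obtain S where S: "finite S" "S \<subseteq> {0<..<1}"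
        "\<forall>t\<in>S. poly s t = 0"
        "(\<forall>x\<in>{0..1}. 0 \<le> poly (s * (\<Prod>t\<in>S. [:-t, 1:])) x) \<or>
         (\<forall>x\<in>{0..1}. poly (s * (\<Prod>t\<in>S. [:-t, 1:])) x \<le> 0)"
      by blast
    \<comment> \<open>Restoring the factor \<open>X - t\<close> flips the parity of the order of
      \<open>t\<close>, so membership of \<open>t\<close> in \<open>S\<close> is toggled. If
      \<open>t\<close> enters, the product gains only a square.\<close>
    show ?thesis
    proof (cases "t \<in> S")
      case True
      have "p * (\<Prod>u\<in>S - {t}. [:-u, 1:]) = s * (\<Prod>u\<in>S. [:-u, 1:])"
        unfolding s prod.remove[OF S(1) True] by (simp only: mult_ac)
      then show ?thesis
        using S t s by (intro exI[of _ "S - {t}"]) auto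
    next
      case False
      have eq: "p * (\<Prod>u\<in>insert t S. [:-u, 1:]) = [:-t, 1:]\<^sup>2 * (s * (\<Prod>u\<in>S. [:-u, 1:]))"
        unfolding s prod.insert[OF S(1) False] by (simp only: mult_ac power2_eq_square)
      have "poly ([:-t, 1:]\<^sup>2 * (s * (\<Prod>u\<in>S. [:-u, 1:]))) x
          = (x - t)\<^sup>2 * poly (s * (\<Prod>u\<in>S. [:-u, 1:])) x" for x
        by (simp add: poly_power)
      then show ?thesis
        using S t s unfolding eq[symmetric]
        by (intro exI[of _ "insert t S"]) (auto simp: zero_le_mult_iff mult_le_0_iff)
    qed
  qed
qed

lemma degree_prod_linear:
  fixes S :: "real set"
  shows "degree (\<Prod>t\<in>S. [:-t, 1:]) = card S"
  by (subst degree_prod_eq_sum_degree) auto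

lemma lead_coeff_prod_linear:
  fixes S :: "real set"
  shows "lead_coeff (\<Prod>t\<in>S. [:-t, 1:]) = 1"
  by (simp add: lead_coeff_prod)

lemma poly_prod_linear_eq_0:
  fixes S :: "real set"
  shows "finite S \<Longrightarrow> poly (\<Prod>t\<in>S. [:-t, 1:]) x = 0 \<longleftrightarrow> x \<in> S"
  by (auto simp: poly_prod)

lemma prod_linear_dvd:
  fixes p :: "real poly"
  assumes "finite S" and "\<And>t. t \<in> S \<Longrightarrow> poly p t = 0"
  shows "(\<Prod>t\<in>S. [:-t, 1:]) dvd p"
  using assms
proof (induction S arbitrary: p)
  case empty
  then show ?case by simp
next
  case (insert t S)
  obtain s where s: "p = [:-t, 1:] * s"
    using insert.prems[of t] by (auto simp: poly_eq_0_iff_dvd elim: dvdE)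
  have "(\<Prod>t\<in>S. [:-t, 1:]) dvd s"
  proof (rule insert.IH)
    fix u assume "u \<in> S"
    then show "poly s u = 0"
      using insert.prems[of u] insert.hyps(2) s by auto
  qed
  then show ?case
    unfolding s prod.insert[OF insert.hyps] by (rule mult_dvd_mono[OF dvd_refl])
qed

section \<open>Lagrange interpolation and orthogonal polynomials\<close>

definition lagrange_basis :: "real set \<Rightarrow> real \<Rightarrow> real poly" where
  "lagrange_basis T t = smult (inverse (\<Prod>s\<in>T - {t}. t - s)) (\<Prod>s\<in>T - {t}. [:-s, 1:])"

lemma poly_lagrange_basis:
  assumes "finite T" "t \<in> T" "s \<in> T"
  shows "poly (lagrange_basis T t) s = (if s = t then 1 else 0)"
  using assms by (auto simp: lagrange_basis_def poly_prod)

lemma degree_lagrange_basis: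
  assumes "finite T" "t \<in> T"
  shows "degree (lagrange_basis T t) < card T"
proof -
  have "degree (lagrange_basis T t) \<le> card (T - {t})"
    unfolding lagrange_basis_def using degree_smult_le degree_prod_linear by metis
  also have "\<dots> < card T"
    using assms by (rule card_Diff1_less)
  finally show ?thesis .
qed

text \<open>Gram-Schmidt for the form \<open>L (p * q)\<close>. The form may be degenerate, as
  happens for finitely supported distributions; \<open>degen\<close> places polynomials of norm zero
  in its kernel, which is all that the projection step needs.\<close>

lemma orthogonal_projection_poly:
  fixes L :: "real poly \<Rightarrow> real"
  assumes add: "\<And>p q. L (p + q) = L p + L q"
    and smult: "\<And>c p. L (smult c p) = c * L p"
    and degen: "\<And>p q. L (p * p) = 0 \<Longrightarrow> L (p * q) = 0"
  shows "\<exists>r. (r = 0 \<or> degree r < n) \<and> (\<forall>q. q = 0 \<or> degree q < n \<longrightarrow> L ((g - r) * q) = 0)"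
proof (induction n arbitrary: g)
  case 0
  have "L 0 = 0" using smult[of 0 0] by simp
  then show ?case by (intro exI[of _ 0]) auto
next
  case (Suc n)
  have diff: "L (p - q) = L p - L q" for p q
    using add[of p "smult (-1) q"] smult[of "-1" q] by simp
  obtain a where a: "a = 0 \<or> degree a < n"
      "\<And>q. q = 0 \<or> degree q < n \<Longrightarrow> L ((monom 1 n - a) * q) = 0"
    using Suc.IH[of "monom 1 n"] by blast
  obtain b where b: "b = 0 \<or> degree b < n"
      "\<And>q. q = 0 \<or> degree q < n \<Longrightarrow> L ((g - b) * q) = 0"
    using Suc.IH[of g] by blast
  \<comment> \<open>\<open>e\<close> is the monic orthogonal polynomial of degree \<open>n\<close>,
    the one new direction; the projection gains a multiple of it.\<close>
  define e where "e = monom 1 n - a"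
  have dege: "degree e \<le> n" and ce: "coeff e n = 1"
    unfolding e_def using a(1) by (auto intro!: degree_diff_le degree_monom_le simp: coeff_eq_0)
  \<comment> \<open>If \<open>L (e * e) = 0\<close>, then also \<open>L (g * e) = 0\<close>, and the junk value \<open>c = 0\<close> is a valid choice.\<close>
  define c where "c = L (g * e) / L (e * e)"
  have c: "c * L (e * e) = L (g * e)"
    using degen[of e g] by (auto simp: c_def mult.commute)
  define r where "r = b + smult c e"
  have "degree r < Suc n"
    unfolding r_def using b(1) dege degree_smult_le[of c e]
    by (intro le_imp_less_Suc degree_add_le) auto
  moreover have "L ((g - r) * q) = 0" if q: "q = 0 \<or> degree q < Suc n" for q
  proof -
    \<comment> \<open>Splitting off the multiple of \<open>e\<close> with the coefficient of
      \<open>q\<close> at \<open>n\<close> leaves a test polynomial of degree below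
      \<open>n\<close>, to which both induction hypotheses apply.\<close>
    define q' where "q' = q - smult (coeff q n) e"
    have q': "q' = 0 \<or> degree q' < n"
    proof -
      have "degree q' \<le> n"
        unfolding q'_def using q dege degree_smult_le[of "coeff q n" e]
        by (intro degree_diff_le) auto
      moreover have "coeff q' n = 0"
        by (simp add: q'_def ce)
      ultimately show ?thesis
        by (metis leading_coeff_0_iff le_neq_implies_less)
    qed
    have 1: "L ((g - b) * q') = 0" and 2: "L (e * q') = 0"
      using b(2)[OF q'] a(2)[OF q'] by (auto simp: e_def)
    have 3: "L (e * b) = 0"
      using a(2)[OF b(1)] by (auto simp: e_def)
    have "L ((g - b) * e) = L (g * e) - L (e * b)"
      unfolding diff[symmetric] by (simp add: algebra_simps)
    then have 4: "L ((g - b) * e) = L (g * e)"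
      using 3 by simp
    have "(g - r) * q = (g - b) * q' + smult (coeff q n) ((g - b) * e)
        - (smult c (e * q') + smult (c * coeff q n) (e * e))"
      by (simp add: r_def q'_def algebra_simps smult_add_right smult_diff_right)
    then have "L ((g - r) * q) = coeff q n * L (g * e) - c * coeff q n * L (e * e)"
      by (simp add: diff add smult 1 2 4)
    also have "\<dots> = 0"
      unfolding c[symmetric] by simp
    finally show ?thesis .
  qed
  ultimately show ?case by blast
qed

text \<open>The polynomial is the error of projecting the monomial of degree \<open>n\<close> onto
  the lower degrees.\<close>

lemma monic_orthogonal_poly:
  fixes L :: "real poly \<Rightarrow> real"
  assumes "\<And>p q. L (p + q) = L p + L q"
    and "\<And>c p. L (smult c p) = c * L p"
    and "\<And>p q. L (p * p) = 0 \<Longrightarrow> L (p * q) = 0"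
  shows "\<exists>p. degree p = n \<and> lead_coeff p = 1 \<and> (\<forall>q. q = 0 \<or> degree q < n \<longrightarrow> L (p * q) = 0)"
proof -
  obtain r where r: "r = 0 \<or> degree r < n"
      "\<And>q. q = 0 \<or> degree q < n \<Longrightarrow> L ((monom 1 n - r) * q) = 0"
    using orthogonal_projection_poly[of L n "monom 1 n"] assms by blast
  have "coeff (monom 1 n - r) n = 1"
    using r(1) by (auto simp: coeff_eq_0)
  moreover have "degree (monom 1 n - r) \<le> n"
    using r(1) by (auto intro!: degree_diff_le degree_monom_le)
  ultimately have "degree (monom 1 n - r) = n"
    by (metis le_antisym le_degree one_neq_zero)
  with \<open>coeff (monom 1 n - r) n = 1\<close> r(2) show ?thesis
    by (intro exI[of _ "monom 1 n - r"]) auto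
qed

subsection \<open>Distributions on the unit interval\<close>

lemma unit_distributionsD:
  assumes "F \<in> unit_distributions"
  shows "prob_space F" and "sets F = sets borel" and "space F = UNIV"
    and "AE x in F. x \<in> {0..1}"
  using assms real_distribution.space_eq_univ[of F]
  by (auto simp: unit_distributions_def real_distribution_def real_distribution_axioms_def)

text \<open>Continuity is asked on the unit interval only, because logarithms and reciprocals with
  singularities outside it are integrated later. Compactness provides the bound.\<close>

lemma integrable_unit_distribution:
  fixes h :: "real \<Rightarrow> real"
  assumes F: "F \<in> unit_distributions" and h: "h \<in> borel_measurable borel"
    and c: "continuous_on {0..1} h"
  shows "integrable F h"
proof -
  interpret prob_space F by (rule unit_distributionsD[OF F])
  obtain B where "\<forall>y \<in> h ` {0..1}. norm y \<le> B"
    using compact_imp_bounded[OF compact_continuous_image[OF c]] unfolding bounded_iff by auto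
  then have "AE x in F. norm (h x) \<le> B"
    using unit_distributionsD(4)[OF F] by auto
  moreover have "h \<in> borel_measurable F"
    using h unit_distributionsD(2)[OF F] measurable_cong_sets by blast
  ultimately show ?thesis by (rule integrable_const_bound)
qed

lemma continuous_on_real_poly: "continuous_on A (poly (p :: real poly))"
  by (intro continuous_at_imp_continuous_on) simp

lemma borel_measurable_real_poly [measurable]: "poly (p :: real poly) \<in> borel_measurable borel"
  by (intro borel_measurable_continuous_onI continuous_on_real_poly)

lemma integrable_poly [simp]:
  assumes "F \<in> unit_distributions"
  shows "integrable F (poly p)"
  using assms by (rule integrable_unit_distribution) (auto intro: continuous_on_real_poly)

lemma integrable_power_unit_distribution [simp]:
  assumes "F \<in> unit_distributions"
  shows "integrable F (\<lambda>x. x ^ n)"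
  using assms by (rule integrable_unit_distribution) (auto intro: continuous_intros)

lemma integral_poly:
  assumes "F \<in> unit_distributions"
  shows "(\<integral>x. poly p x \<partial>F) = (\<Sum>i\<le>degree p. coeff p i * (\<integral>x. x ^ i \<partial>F))"
  using assms by (simp add: poly_altdef)

lemma moment_classD:
  assumes "F \<in> moment_class d M"
  shows "F \<in> unit_distributions" and "m \<in> {1..d} \<Longrightarrow> (\<integral>x. x ^ m \<partial>F) = M m"
  using assms by (auto simp: moment_class_def)

lemma moment_class_integral_power:
  assumes "F \<in> moment_class d M" and "m \<le> d"
  shows "(\<integral>x. x ^ m \<partial>F) = (M(0 := 1)) m"
proof (cases "m = 0")
  case True
  interpret prob_space F by (rule unit_distributionsD[OF moment_classD(1)[OF assms(1)]])
  show ?thesis using True by (simp add: prob_space)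
qed (use moment_classD(2)[OF assms(1)] assms(2) in auto)

lemma moment_class_integral_poly:
  assumes "F \<in> moment_class d M" and "G \<in> moment_class d M" and "degree p \<le> d"
  shows "(\<integral>x. poly p x \<partial>F) = (\<integral>x. poly p x \<partial>G)"
proof -
  have "(\<integral>x. x ^ i \<partial>F) = (\<integral>x. x ^ i \<partial>G)" if "i \<le> degree p" for i
    using moment_class_integral_power assms that order.trans by metis
  then show ?thesis
    using assms by (simp add: integral_poly moment_classD)
qed

lemma integral_poly_nonneg:
  assumes F: "F \<in> unit_distributions" and nn: "\<And>x. x \<in> {0..1} \<Longrightarrow> 0 \<le> poly p x"
  shows "0 \<le> (\<integral>x. poly p x \<partial>F)"
  using unit_distributionsD(4)[OF F] nn by (intro integral_nonneg_AE) auto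

lemma integral_poly_nonpos:
  assumes F: "F \<in> unit_distributions" and np: "\<And>x. x \<in> {0..1} \<Longrightarrow> poly p x \<le> 0"
  shows "(\<integral>x. poly p x \<partial>F) \<le> 0"
  using integral_poly_nonneg[OF F, of "- p"] np by simp

text \<open>The device for reading off supports: equality in an extremal inequality confines the
  distribution to the roots.\<close>

lemma AE_poly_eq_0:
  assumes F: "F \<in> unit_distributions"
    and sgn: "(\<forall>x\<in>{0..1}. 0 \<le> poly p x) \<or> (\<forall>x\<in>{0..1}. poly p x \<le> 0)"
    and int: "(\<integral>x. poly p x \<partial>F) = 0"
  shows "AE x in F. poly p x = 0"
proof -
  note AE = unit_distributionsD(4)[OF F]
  show ?thesis
    using sgn
  proof
    assume nn: "\<forall>x\<in>{0..1}. 0 \<le> poly p x"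
    have "AE x in F. 0 \<le> poly p x" using AE nn by auto
    then show ?thesis
      using int integral_nonneg_eq_0_iff_AE[of F "poly p"] F by simp
  next
    assume np: "\<forall>x\<in>{0..1}. poly p x \<le> 0"
    have "AE x in F. 0 \<le> poly (- p) x" using AE np by auto
    moreover have "(\<integral>x. poly (- p) x \<partial>F) = 0" using int by simp
    ultimately have "AE x in F. poly (- p) x = 0"
      using integral_nonneg_eq_0_iff_AE[of F "poly (- p)"] integrable_poly[OF F, of "- p"] by blast
    then show ?thesis by simp
  qed
qed

lemma integral_finite_support:
  fixes h :: "real \<Rightarrow> real"
  assumes F: "F \<in> unit_distributions" and T: "finite T" "AE x in F. x \<in> T"
    and h: "h \<in> borel_measurable borel"
  shows "(\<integral>x. h x \<partial>F) = (\<Sum>t\<in>T. measure F {t} * h t)"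
proof -
  interpret prob_space F by (rule unit_distributionsD[OF F])
  note [measurable_cong] = unit_distributionsD(2)[OF F]
  have [measurable]: "h \<in> borel_measurable borel" by (rule h)
  have [simp]: "{t} \<in> sets F" for t
    by (simp add: unit_distributionsD(2)[OF F])
  have "h x = (\<Sum>t\<in>T. indicator {t} x * h t)" if "x \<in> T" for x
    using that T(1) by (subst sum.remove[of _ x]) (auto simp: indicator_def intro!: sum.neutral)
  then have "(\<integral>x. h x \<partial>F) = (\<integral>x. (\<Sum>t\<in>T. indicator {t} x * h t) \<partial>F)"
    using T(2) by (intro integral_cong_AE) auto
  also have "\<dots> = (\<Sum>t\<in>T. measure F {t} * h t)"
    by (subst Bochner_Integration.integral_sum)
       (auto simp: unit_distributionsD(3)[OF F] less_top[symmetric])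
  finally show ?thesis .
qed

text \<open>On at most \<open>d + 1\<close> points the Lagrange basis polynomials have degree at
  most \<open>d\<close>, so their integrals, which are the point masses, are determined by the
  moments.\<close>

lemma moment_class_eqI:
  assumes F: "F \<in> moment_class d M" and G: "G \<in> moment_class d M"
    and T: "finite T" "card T \<le> Suc d" and "AE x in F. x \<in> T" "AE x in G. x \<in> T"
  shows "F = G"
proof (rule measure_eqI)
  note uF = moment_classD(1)[OF F] and uG = moment_classD(1)[OF G]
  interpret F: prob_space F by (rule unit_distributionsD[OF uF])
  interpret G: prob_space G by (rule unit_distributionsD[OF uG])
  show "sets F = sets G"
    using uF uG by (simp add: unit_distributionsD)
  fix A assume "A \<in> sets F"
  then have A: "A \<in> sets borel"
    using uF by (simp add: unit_distributionsD)
  have "measure F {t} = measure G {t}" if t: "t \<in> T" for t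
  proof -
    have *: "(\<integral>x. poly (lagrange_basis T t) x \<partial>H) = measure H {t}"
      if "H \<in> unit_distributions" "AE x in H. x \<in> T" for H
      using that T(1) t
      by (simp add: integral_finite_support poly_lagrange_basis if_distrib[of "(*) _"]
          cong: if_cong)
    have "degree (lagrange_basis T t) \<le> d"
      using degree_lagrange_basis[OF T(1) t] T(2) by simp
    then show ?thesis
      using moment_class_integral_poly[OF F G] * uF uG assms(5,6) by metis
  qed
  moreover have "measure H A = (\<Sum>t\<in>T. measure H {t} * indicator A t)"
    if "H \<in> unit_distributions" "AE x in H. x \<in> T" for H
  proof -
    have "measure H A = (\<integral>x. indicator A x \<partial>H)"
      using that by (simp add: unit_distributionsD)
    also have "\<dots> = (\<Sum>t\<in>T. measure H {t} * indicator A t)"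
      using that T A by (intro integral_finite_support) auto
    finally show ?thesis .
  qed
  ultimately have "measure F A = measure G A"
    using uF uG assms(5,6) by simp
  then show "emeasure F A = emeasure G A"
    by (simp add: F.emeasure_eq_measure G.emeasure_eq_measure)
qed

subsection \<open>Node sets\<close>

definition fixed_nodes :: "nat \<Rightarrow> real set" where
  "fixed_nodes d = (if odd d then {0, 1} else {1})"

definition node_set :: "nat \<Rightarrow> real set \<Rightarrow> bool" where
  "node_set d T \<longleftrightarrow>
    finite T \<and> T \<subseteq> {0..1} \<and> card T = num_points d \<and> fixed_nodes d \<subseteq> T"

text \<open>Free nodes are double roots, so the node polynomial keeps its sign there. With simple
  prescribed endpoints the multiplicities of a node set add up to \<open>d + 1\<close>.\<close>

definition node_mult :: "nat \<Rightarrow> real \<Rightarrow> nat" where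
  "node_mult d t = (if t \<in> fixed_nodes d then 1 else 2)"

definition node_poly :: "nat \<Rightarrow> real set \<Rightarrow> real poly" where
  "node_poly d T = (\<Prod>t\<in>T. [:-t, 1:] ^ node_mult d t)"

lemma finite_fixed_nodes [simp]: "finite (fixed_nodes d)"
  by (simp add: fixed_nodes_def)

lemma fixed_nodes_subset: "fixed_nodes d \<subseteq> {0..1}"
  by (simp add: fixed_nodes_def)

lemma num_points_eq: "num_points d = d div 2 + card (fixed_nodes d)"
proof (cases "odd d")
  case True
  then obtain k where k: "d = 2 * k + 1" by (rule oddE)
  have "\<lceil>real d / 2\<rceil> = int (Suc k)" unfolding k by (simp add: ceiling_eq_iff)
  then show ?thesis using k by (simp add: num_points_def fixed_nodes_def)
next
  case False
  then obtain k where k: "d = 2 * k" by blast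
  have "\<lceil>real d / 2\<rceil> = int k" unfolding k by simp
  then show ?thesis using k by (simp add: num_points_def fixed_nodes_def)
qed

text \<open>The parameter count of the quadrature: two for each free node and one for each
  prescribed node, against \<open>d + 1\<close> moment conditions.\<close>

lemma card_fixed_nodes: "2 * (d div 2) + card (fixed_nodes d) = Suc d"
  by (cases "odd d") (auto simp: fixed_nodes_def elim!: oddE)

lemma degree_node_poly_subset:
  "finite T \<Longrightarrow> degree (node_poly d T) = (\<Sum>t\<in>T. node_mult d t)"
  unfolding node_poly_def by (subst degree_prod_eq_sum_degree) (auto simp: degree_power_eq)

lemma lead_coeff_node_poly: "lead_coeff (node_poly d T) = 1"
  unfolding node_poly_def by (simp add: lead_coeff_prod lead_coeff_power)

lemma poly_node_poly:
  "poly (node_poly d T) x = (\<Prod>t\<in>T. (x - t) ^ node_mult d t)"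
  by (simp add: node_poly_def poly_prod poly_power)

lemma poly_node_poly_eq_0: "finite T \<Longrightarrow> poly (node_poly d T) x = 0 \<longleftrightarrow> x \<in> T"
  by (auto simp: poly_node_poly node_mult_def)

lemma degree_node_poly:
  assumes "node_set d T"
  shows "degree (node_poly d T) = Suc d"
proof -
  have T: "finite T" "fixed_nodes d \<subseteq> T" "card T = num_points d"
    using assms by (auto simp: node_set_def)
  have "(\<Sum>t\<in>T. node_mult d t)
      = (\<Sum>t\<in>fixed_nodes d. node_mult d t) + (\<Sum>t\<in>T - fixed_nodes d. node_mult d t)"
    using T by (simp add: sum.subset_diff add.commute)
  also have "\<dots> = card (fixed_nodes d) + 2 * card (T - fixed_nodes d)"
    by (simp add: node_mult_def)
  also have "card (T - fixed_nodes d) = d div 2"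
    using T by (simp add: card_Diff_subset num_points_eq)
  finally show ?thesis
    using T card_fixed_nodes[of d] by (simp add: degree_node_poly_subset)
qed

text \<open>Once a node is dropped, the integral of the polynomial is determined by the moments.
  This serves both the positivity of quadrature weights and the case of no mass at 1.\<close>

lemma degree_node_poly_remove:
  assumes "node_set d T" and "t \<in> T"
  shows "degree (node_poly d (T - {t})) \<le> d"
proof -
  have "finite T" using assms by (simp add: node_set_def)
  then have "Suc d = node_mult d t + degree (node_poly d (T - {t}))"
    using degree_node_poly[OF assms(1)] assms(2) by (simp add: degree_node_poly_subset sum.remove)
  then show ?thesis by (auto simp: node_mult_def split: if_splits)
qed

text \<open>Every node other than 1 contributes a square or, at a prescribed 0, the factor
  \<open>x\<close>. Only the simple factor \<open>x - 1\<close> can be negative on the unit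
  interval.\<close>

lemma poly_node_poly_nonneg:
  assumes "finite T" and "1 \<notin> T" and "x \<in> {0..1}"
  shows "0 \<le> poly (node_poly d T) x"
  unfolding poly_node_poly using assms
  by (intro prod_nonneg) (auto simp: node_mult_def fixed_nodes_def)

lemma poly_node_poly_nonpos:
  assumes "finite T" and "1 \<in> T" and "x \<in> {0..1}"
  shows "poly (node_poly d T) x \<le> 0"
proof -
  have "poly (node_poly d T) x = (x - 1) * poly (node_poly d (T - {1})) x"
    using assms by (simp add: poly_node_poly prod.remove node_mult_def fixed_nodes_def)
  moreover have "0 \<le> poly (node_poly d (T - {1})) x"
    using assms by (intro poly_node_poly_nonneg) auto
  ultimately show ?thesis using assms(3) by (simp add: mult_nonpos_nonneg)
qed

lemma node_setD:
  assumes "node_set d T"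
  shows "finite T" and "T \<subseteq> {0..1}" and "1 \<in> T" and "fixed_nodes d \<subseteq> T"
    and "d \<ge> 1 \<Longrightarrow> card T \<le> Suc d"
proof -
  show "card T \<le> Suc d" if "d \<ge> 1"
    using assms card_fixed_nodes[of d] by (simp add: node_set_def num_points_eq)
qed (use assms in \<open>auto simp: node_set_def fixed_nodes_def split: if_splits\<close>)

text \<open>Both distributions maximise the moment of order \<open>d + 1\<close>, because the node polynomials are
  monic of that degree and nonpositive on the unit interval.\<close>

lemma node_set_supported_unique:
  assumes d: "d \<ge> 1"
    and F: "F \<in> moment_class d M" "node_set d S" "AE x in F. x \<in> S"
    and G: "G \<in> moment_class d M" "node_set d T" "AE x in G. x \<in> T"
  shows "F = G"
proof -
  note uF = moment_classD(1)[OF F(1)] and uG = moment_classD(1)[OF G(1)]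
  have zero: "(\<integral>x. poly (node_poly d U) x \<partial>H) = 0"
    if "H \<in> unit_distributions" "node_set d U" "AE x in H. x \<in> U" for H U
    using that integral_finite_support[of H U "poly (node_poly d U)"]
      poly_node_poly_eq_0[OF node_setD(1)[OF that(2)], of d]
    by (simp add: node_setD(1)[OF that(2)] sum.neutral)
  have "degree (node_poly d S - node_poly d T) \<le> d"
  proof -
    have "degree (node_poly d S - node_poly d T) \<le> Suc d"
      using F G by (intro degree_diff_le) (simp_all add: degree_node_poly)
    moreover have "coeff (node_poly d S - node_poly d T) (Suc d) = 0"
      using lead_coeff_node_poly[of d S] lead_coeff_node_poly[of d T] F G
      by (simp add: degree_node_poly)
    ultimately show ?thesis
      by (metis degree_0 le_SucE leading_coeff_0_iff zero_le)
  qed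
  \<comment> \<open>Each node polynomial integrates to zero against its own distribution, so this
    equates a nonnegative with a nonpositive number, and both vanish.\<close>
  from moment_class_integral_poly[OF F(1) G(1) this]
  have "- (\<integral>x. poly (node_poly d T) x \<partial>F) = (\<integral>x. poly (node_poly d S) x \<partial>G)"
    using uF uG zero[OF uF F(2,3)] zero[OF uG G(2,3)] by simp
  moreover have "(\<integral>x. poly (node_poly d T) x \<partial>F) \<le> 0"
    using uF node_setD[OF G(2)] by (intro integral_poly_nonpos poly_node_poly_nonpos) auto
  moreover have "(\<integral>x. poly (node_poly d S) x \<partial>G) \<le> 0"
    using uG node_setD[OF F(2)] by (intro integral_poly_nonpos poly_node_poly_nonpos) auto
  ultimately have "(\<integral>x. poly (node_poly d T) x \<partial>F) = 0" by linarith
  then have "AE x in F. poly (node_poly d T) x = 0"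
    using uF node_setD[OF G(2)] poly_node_poly_nonpos by (intro AE_poly_eq_0) auto
  then have "AE x in F. x \<in> T"
    using node_setD(1)[OF G(2)] by (simp add: poly_node_poly_eq_0)
  then show ?thesis
    using node_setD[OF G(2)] d F G by (intro moment_class_eqI[of F d M G T]) auto
qed

subsection \<open>Finite quadrature with prescribed nodes\<close>

text \<open>The weight $1 - x$ or $x (1 - x)$ whose zeros are the prescribed nodes.\<close>

definition node_weight :: "nat \<Rightarrow> real poly" where
  "node_weight d = - (\<Prod>t\<in>fixed_nodes d. [:-t, 1:])"

lemma poly_node_weight_nonneg: "x \<in> {0..1} \<Longrightarrow> 0 \<le> poly (node_weight d) x"
  by (auto simp: node_weight_def fixed_nodes_def mult_nonneg_nonneg algebra_simps
      mult_left_le)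

lemma poly_node_weight_eq_0: "poly (node_weight d) x = 0 \<longleftrightarrow> x \<in> fixed_nodes d"
  by (simp add: node_weight_def poly_prod_linear_eq_0)

text \<open>Here \<open>F\<close> is its own quadrature rule; arbitrary further nodes of mass zero
  are added until the free ones number exactly \<open>d div 2\<close>.\<close>

lemma quadrature_of_small_support:
  assumes F: "F \<in> moment_class d M"
    and S: "finite S" "card S \<le> d div 2" "AE x in F. x \<in> S \<union> fixed_nodes d"
  shows "\<exists>T g. node_set d T \<and> (\<forall>t\<in>T. 0 \<le> g t) \<and>
    (\<forall>m\<le>d. (\<Sum>t\<in>T. g t * t ^ m) = (M(0 := 1)) m)"
proof -
  note uF = moment_classD(1)[OF F]
  define S' where "S' = S \<inter> {0..1} - fixed_nodes d"
  have S': "finite S'" "card S' \<le> d div 2" "S' \<subseteq> {0..1} - fixed_nodes d"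
    unfolding S'_def using S(1) by (auto intro!: order.trans[OF card_mono[OF S(1)] S(2)])
  have "infinite ({0..1} - fixed_nodes d)"
    by (simp add: infinite_Icc Diff_infinite_finite)
  then have "infinite ({0..1} - fixed_nodes d - S')"
    using S'(1) by (rule Diff_infinite_finite[rotated])
  then obtain U where U: "U \<subseteq> {0..1} - fixed_nodes d - S'" "finite U" "card U = d div 2 - card S'"
    using infinite_arbitrarily_large by blast
  define T where "T = fixed_nodes d \<union> (S' \<union> U)"
  have "card (S' \<union> U) = d div 2"
    using S' U by (subst card_Un_disjoint) auto
  then have "card T = num_points d"
    unfolding T_def num_points_eq using S' U by (subst card_Un_disjoint) auto
  then have T: "node_set d T"
    using S' U fixed_nodes_subset by (auto simp: node_set_def T_def)
  have "AE x in F. x \<in> T"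
    using S(3) unit_distributionsD(4)[OF uF] by eventually_elim (auto simp: T_def S'_def)
  then have "(\<Sum>t\<in>T. measure F {t} * t ^ m) = (M(0 := 1)) m" if "m \<le> d" for m
    using integral_finite_support[OF uF node_setD(1)[OF T], of "\<lambda>x. x ^ m"]
      moment_class_integral_power[OF F that] by simp
  then show ?thesis
    using T by (intro exI[of _ T] exI[of _ "\<lambda>t. measure F {t}"]) auto
qed

text \<open>Gauss--Radau (\<open>d\<close> even) and Gauss--Lobatto (\<open>d\<close> odd) quadrature: the free nodes are the roots of
  the orthogonal polynomial of degree \<open>d div 2\<close>. If that polynomial has too few sign changes, then
  \<open>F\<close> itself is supported on few points.\<close>

lemma quadrature_exists:
  assumes F: "F \<in> moment_class d M"
  shows "\<exists>T g. node_set d T \<and> (\<forall>t\<in>T. 0 \<le> g t) \<and>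
    (\<forall>m\<le>d. (\<Sum>t\<in>T. g t * t ^ m) = (M(0 := 1)) m)"
proof (cases "\<exists>S. finite S \<and> card S \<le> d div 2 \<and> (AE x in F. x \<in> S \<union> fixed_nodes d)")
  case True
  then show ?thesis using quadrature_of_small_support[OF F] by blast
next
  case large: False
  note uF = moment_classD(1)[OF F]
  define w where "w = node_weight d"
  define n where "n = d div 2"
  define L where "L q = (\<integral>x. poly (w * q) x \<partial>F)" for q
  have L_add: "L (p + q) = L p + L q" for p q
    unfolding L_def distrib_left poly_add using uF
    by (intro Bochner_Integration.integral_add integrable_poly)
  have L_smult: "L (smult c p) = c * L p" for c p
    unfolding L_def mult_smult_right poly_smult by (rule integral_mult_right_zero)
  \<comment> \<open>The integrand of \<open>L (p * p)\<close> is nonnegative on the unit interval,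
    so a zero integral makes \<open>w * p\<close> vanish almost surely, and with it every product
    \<open>w * (p * q)\<close>.\<close>
  have L_degen: "L (p * q) = 0" if "L (p * p) = 0" for p q
  proof -
    have "AE x in F. poly (w * (p * p)) x = 0"
    proof (rule AE_poly_eq_0[OF uF])
      show "(\<integral>x. poly (w * (p * p)) x \<partial>F) = 0"
        using that by (simp add: L_def del: poly_mult)
    qed (use poly_node_weight_nonneg[of _ d] in \<open>auto simp: w_def\<close>)
    then have "AE x in F. poly (w * (p * q)) x = 0" by auto
    then show ?thesis unfolding L_def
      using integral_cong_AE[of "poly (w * (p * q))" F "\<lambda>_. 0"] uF
      by (simp add: borel_measurable_integrable del: poly_mult)
  qed
  obtain p where p: "degree p = n" "lead_coeff p = 1"
      and orth: "\<And>q. q = 0 \<or> degree q < n \<Longrightarrow> L (p * q) = 0"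
    using monic_orthogonal_poly[of L n] L_add L_smult L_degen by blast
  have "p \<noteq> 0" using p(2) by auto
  obtain S where S: "finite S" "S \<subseteq> {0<..<1}" "\<forall>t\<in>S. poly p t = 0"
      and sgn: "(\<forall>x\<in>{0..1}. 0 \<le> poly (p * (\<Prod>t\<in>S. [:-t, 1:])) x) \<or>
        (\<forall>x\<in>{0..1}. poly (p * (\<Prod>t\<in>S. [:-t, 1:])) x \<le> 0)"
    using poly_sign_changes[OF \<open>p \<noteq> 0\<close>] by blast
  have "finite {x. poly p x = 0}" and roots: "card {x. poly p x = 0} \<le> n"
    using poly_roots_finite[OF \<open>p \<noteq> 0\<close>] card_poly_roots_bound[OF \<open>p \<noteq> 0\<close>] p(1) by auto
  then have "card S \<le> n"
    using S(3) by (intro order.trans[OF card_mono roots]) auto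
  \<comment> \<open>With fewer than \<open>n\<close> sign changes, \<open>p\<close> would be
    orthogonal to the product over \<open>S\<close>, although \<open>w * ?P\<close> has constant
    sign. Then \<open>F\<close> would live on the roots of \<open>p\<close> and the prescribed
    nodes, which \<open>large\<close> excludes.\<close>
  moreover have "\<not> card S < n"
  proof
    assume "card S < n"
    let ?P = "p * (\<Prod>t\<in>S. [:-t, 1:])"
    have "L ?P = 0"
      using \<open>card S < n\<close> by (intro orth) (simp add: degree_prod_linear)
    moreover have "(\<forall>x\<in>{0..1}. 0 \<le> poly (w * ?P) x) \<or> (\<forall>x\<in>{0..1}. poly (w * ?P) x \<le> 0)"
      using sgn poly_node_weight_nonneg[of _ d] unfolding poly_mult[of w] w_def
      by (auto intro: mult_nonneg_nonneg mult_nonneg_nonpos)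
    ultimately have "AE x in F. poly (w * ?P) x = 0"
      unfolding L_def using uF by (intro AE_poly_eq_0)
    then have "AE x in F. x \<in> {x. poly p x = 0} \<union> fixed_nodes d"
      by eventually_elim
        (use S in \<open>auto simp: w_def poly_node_weight_eq_0 poly_prod_linear_eq_0\<close>)
    with large roots \<open>finite {x. poly p x = 0}\<close> show False
      unfolding n_def by blast
  qed
  ultimately have cardS: "card S = n" by simp
  have p_eq: "p = (\<Prod>t\<in>S. [:-t, 1:])"
  proof -
    obtain c where c: "p = (\<Prod>t\<in>S. [:-t, 1:]) * c"
      using prod_linear_dvd[OF S(1), of p] S(3) by (auto elim: dvdE)
    have "c \<noteq> 0" using \<open>p \<noteq> 0\<close> c by auto
    then have "degree c = 0"
      using p(1) cardS S(1) unfolding c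
      by (subst (asm) degree_mult_eq) (auto simp: degree_prod_linear)
    then obtain a where "c = [:a:]" by (rule degree_eq_zeroE)
    moreover have "lead_coeff c = 1"
      using p(2) unfolding c lead_coeff_mult lead_coeff_prod_linear by simp
    ultimately show ?thesis using c by simp
  qed
  define T where "T = fixed_nodes d \<union> S"
  have disj: "fixed_nodes d \<inter> S = {}"
    using S(2) by (auto simp: fixed_nodes_def)
  have "card T = num_points d"
    unfolding T_def num_points_eq using disj S(1) cardS by (simp add: card_Un_disjoint n_def)
  then have T: "node_set d T"
    using S fixed_nodes_subset by (fastforce simp: node_set_def T_def)
  have finT: "finite T" and "fixed_nodes d \<subseteq> T"
    using T by (auto simp: node_set_def)
  have prodT: "(\<Prod>t\<in>T. [:-t, 1:]) = - (w * p)"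
    unfolding T_def p_eq w_def node_weight_def using disj S(1) by (simp add: prod.union_disjoint)
  \<comment> \<open>The interpolatory weights: integrating the Lagrange interpolant over
    \<open>T\<close> gives the rule.\<close>
  define g where "g t = (\<integral>x. poly (lagrange_basis T t) x \<partial>F)" for t
  have cardT: "card T + n = Suc d"
    using card_fixed_nodes[of d] disj S(1) cardS by (simp add: T_def card_Un_disjoint n_def)
  \<comment> \<open>The interpolation error is divisible by the node product
    \<open>- (w * p)\<close>. As \<open>card T + n = d + 1\<close>, the cofactor has degree below
    \<open>n\<close> or is zero, and orthogonality of \<open>p\<close> kills the integral.\<close>
  have exact: "(\<integral>x. poly q x \<partial>F) = (\<Sum>t\<in>T. g t * poly q t)" if q: "degree q \<le> d" for q
  proof -
    define I where "I = (\<Sum>t\<in>T. smult (poly q t) (lagrange_basis T t))"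
    have "poly I s = poly q s" if "s \<in> T" for s
      using that finT
      by (simp add: I_def poly_sum poly_lagrange_basis if_distrib[of "(*) _"] cong: if_cong)
    then have "(\<Prod>t\<in>T. [:-t, 1:]) dvd q - I"
      using finT by (intro prod_linear_dvd) auto
    then obtain s where s: "q - I = (\<Prod>t\<in>T. [:-t, 1:]) * s"
      by (auto elim: dvdE)
    have "degree (smult (poly q t) (lagrange_basis T t)) \<le> card T - 1" if "t \<in> T" for t
      using degree_smult_le[of "poly q t" "lagrange_basis T t"] degree_lagrange_basis[OF finT that]
      by linarith
    then have "degree I \<le> card T - 1"
      unfolding I_def using finT by (intro degree_sum_le)
    then have "degree (q - I) \<le> d"
      using q cardT finT T by (intro degree_diff_le) (auto simp: card_gt_0_iff)
    then have "s = 0 \<or> degree s < n"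
      using cardT unfolding s
      by (cases "s = 0") (auto simp: degree_mult_eq degree_prod_linear finT)
    then have "L (p * s) = 0" by (rule orth)
    have "q - I = - (w * (p * s))"
      unfolding s prodT by (simp add: mult.assoc)
    then have "(\<integral>x. poly (q - I) x \<partial>F) = - L (p * s)"
      unfolding L_def by (simp del: poly_mult)
    with \<open>L (p * s) = 0\<close> have "(\<integral>x. poly q x \<partial>F) = (\<integral>x. poly I x \<partial>F)"
      using uF by simp
    also have "\<dots> = (\<Sum>t\<in>T. g t * poly q t)"
      using uF by (simp add: I_def poly_sum g_def mult.commute)
    finally show ?thesis .
  qed
  \<comment> \<open>Exactness is tested on the node polynomial without \<open>t\<close>: among the
    nodes it is nonzero only at \<open>t\<close>, and its sign on the unit interval is constant, so
    \<open>g t\<close> is a quotient of two numbers of the same sign.\<close>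
  have "0 \<le> g t" if t: "t \<in> T" for t
  proof -
    let ?R = "node_poly d (T - {t})"
    have "(\<integral>x. poly ?R x \<partial>F) = (\<Sum>s\<in>T. g s * poly ?R s)"
      using degree_node_poly_remove[OF T t] by (rule exact)
    also have "\<dots> = g t * poly ?R t"
      using t finT
      by (auto simp: sum.remove[of T t] poly_node_poly_eq_0 intro!: sum.neutral)
    finally have eq: "(\<integral>x. poly ?R x \<partial>F) = g t * poly ?R t" .
    have nz: "poly ?R t \<noteq> 0" using finT by (simp add: poly_node_poly_eq_0)
    have t01: "t \<in> {0..1}" using T t by (auto simp: node_set_def)
    show ?thesis
    proof (cases "t = 1")
      case True
      then have nn: "0 \<le> poly ?R x" if "x \<in> {0..1}" for x
        using finT that by (intro poly_node_poly_nonneg) auto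
      then have "0 \<le> (\<integral>x. poly ?R x \<partial>F)" by (rule integral_poly_nonneg[OF uF])
      then show ?thesis
        using eq nn[OF t01] nz by (simp add: zero_le_mult_iff)
    next
      case False
      then have np: "poly ?R x \<le> 0" if "x \<in> {0..1}" for x
        using finT that node_setD(3)[OF T] by (intro poly_node_poly_nonpos) auto
      then have "(\<integral>x. poly ?R x \<partial>F) \<le> 0" by (rule integral_poly_nonpos[OF uF])
      then show ?thesis
        using eq np[OF t01] nz by (simp add: mult_le_0_iff)
    qed
  qed
  moreover have "(\<Sum>t\<in>T. g t * t ^ m) = (M(0 := 1)) m" if "m \<le> d" for m
    using exact[of "monom 1 m"] moment_class_integral_power[OF F that] that
    by (simp add: poly_monom degree_monom_eq)
  ultimately show ?thesis using T by blast
qed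

subsection \<open>Point mixtures\<close>

lemma node_set_of_representation:
  assumes "moment_representation d M f x"
  shows "node_set d (x ` {1..num_points d})"
proof -
  let ?l = "num_points d"
  have x: "0 \<le> x 1" "strict_mono_on {1..?l} x" "x ?l \<le> 1"
      "odd d \<Longrightarrow> x 1 = 0 \<and> x ?l = 1" "even d \<Longrightarrow> x ?l = 1"
    using assms by (auto simp: moment_representation_def Let_def)
  have l: "1 \<le> ?l" by (simp add: num_points_def)
  have "card (x ` {1..?l}) = ?l"
    using strict_mono_on_imp_inj_on[OF x(2)] by (simp add: card_image)
  moreover have "x i \<in> {0..1}" if "i \<in> {1..?l}" for i
    using strict_mono_on_leD[OF x(2), of 1 i] strict_mono_on_leD[OF x(2), of i ?l] x(1,3) that
    by auto
  moreover have "x 1 \<in> x ` {1..?l}" "x ?l \<in> x ` {1..?l}"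
    using l by auto
  ultimately show ?thesis
    using x(4,5) by (auto simp: node_set_def fixed_nodes_def)
qed

text \<open>As the image of a weighted counting measure, the mixture inherits formulas for integrals
  and for almost sure statements.\<close>

lemma point_mixture_eq_distr:
  "point_mixture l f x = distr (density (count_space {1..l}) (\<lambda>i. ennreal (f i))) borel x"
proof (rule measure_eqI)
  fix A assume "A \<in> sets (point_mixture l f x)"
  then have A: "A \<in> sets borel" by simp
  have "emeasure (distr (density (count_space {1..l}) (\<lambda>i. ennreal (f i))) borel x) A
      = (\<integral>\<^sup>+i. ennreal (f i) * indicator (x -` A \<inter> {1..l}) i \<partial>count_space {1..l})"
    using A by (simp add: emeasure_distr emeasure_density)
  also have "\<dots> = (\<Sum>i = 1..l. ennreal (f i) * indicator (x -` A \<inter> {1..l}) i)"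
    by (simp add: nn_integral_count_space_finite)
  also have "\<dots> = (\<Sum>i = 1..l. ennreal (f i) * emeasure (return borel (x i)) A)"
    using A by (intro sum.cong) (auto simp: indicator_def)
  finally show "emeasure (point_mixture l f x) A
      = emeasure (distr (density (count_space {1..l}) (\<lambda>i. ennreal (f i))) borel x) A"
    using emeasure_point_mixture[OF A] by simp
qed simp

lemma integral_point_mixture:
  fixes h :: "real \<Rightarrow> real"
  assumes "h \<in> borel_measurable borel" and "\<And>i. i \<in> {1..l} \<Longrightarrow> 0 \<le> f i"
  shows "(\<integral>y. h y \<partial>point_mixture l f x) = (\<Sum>i = 1..l. f i * h (x i))"
proof -
  have "(\<integral>y. h y \<partial>point_mixture l f x)
      = (\<integral>i. h (x i) \<partial>density (count_space {1..l}) (\<lambda>i. ennreal (f i)))"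
    unfolding point_mixture_eq_distr using assms(1) by (intro integral_distr) auto
  also have "\<dots> = (\<integral>i. f i * h (x i) \<partial>count_space {1..l})"
    using assms by (subst integral_density) (auto simp: AE_count_space)
  also have "\<dots> = (\<Sum>i = 1..l. f i * h (x i))"
    by (simp add: lebesgue_integral_count_space_finite)
  finally show ?thesis .
qed

lemma point_mixture_of_representation:
  assumes rep: "moment_representation d M f x"
  defines "F \<equiv> point_mixture (num_points d) f x"
  shows "F \<in> moment_class d M" and "AE y in F. y \<in> x ` {1..num_points d}"
proof -
  let ?l = "num_points d"
  have f: "0 \<le> f i" if "i \<in> {1..?l}" for i
    using rep that by (auto simp: moment_representation_def Let_def)
  have mom: "(\<Sum>i = 1..?l. f i * x i ^ m) = (M(0 := 1)) m" if "m \<le> d" for m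
    using rep that by (auto simp: moment_representation_def Let_def)
  show AE: "AE y in F. y \<in> x ` {1..?l}"
    unfolding F_def point_mixture_eq_distr
    by (subst AE_distr_iff)
      (auto simp: AE_density AE_count_space intro!: borel_closed finite_imp_closed)
  have "space F = UNIV"
    using sets_eq_imp_space_eq[of F borel] by (simp add: F_def)
  then have "emeasure F (space F) = (\<Sum>i = 1..?l. ennreal (f i))"
    unfolding F_def by (simp add: emeasure_point_mixture)
  also have "\<dots> = ennreal (\<Sum>i = 1..?l. f i)"
    using f by (intro sum_ennreal) auto
  also have "(\<Sum>i = 1..?l. f i) = 1"
    using mom[of 0] by simp
  finally have "prob_space F" by (intro prob_spaceI) simp
  moreover have "AE y in F. y \<in> {0..1}"
    using AE node_setD(2)[OF node_set_of_representation[OF rep]] by (auto elim!: eventually_mono)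
  moreover have "sets F = sets borel" by (simp add: F_def)
  ultimately have "F \<in> unit_distributions"
    by (simp add: unit_distributions_def real_distribution_def real_distribution_axioms_def)
  moreover have "(\<integral>y. y ^ m \<partial>F) = M m" if "m \<in> {1..d}" for m
    unfolding F_def using f mom[of m] that by (subst integral_point_mixture) auto
  ultimately show "F \<in> moment_class d M"
    by (simp add: moment_class_def)
qed

lemma representation_of_node_set:
  assumes T: "node_set d T" and g: "\<And>t. t \<in> T \<Longrightarrow> 0 \<le> g t"
    and mom: "\<And>m. m \<le> d \<Longrightarrow> (\<Sum>t\<in>T. g t * t ^ m) = (M(0 := 1)) m"
  shows "\<exists>f x. moment_representation d M f x \<and> x ` {1..num_points d} = T"
proof -
  let ?l = "num_points d"
  have fin: "finite T" and T01: "T \<subseteq> {0..1}" and card: "card T = ?l"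
      and fixed: "fixed_nodes d \<subseteq> T"
    using T by (auto simp: node_set_def)
  have l: "1 \<le> ?l" by (simp add: num_points_def)
  \<comment> \<open>Nodes are numbered from 1 and list positions from 0, hence the shift.\<close>
  define x where "x i = sorted_list_of_set T ! (i - 1)" for i :: nat
  have mono: "strict_mono_on {1..?l} x"
    unfolding x_def using sorted_wrt_nth_less[OF strict_sorted_list_of_set[of T]] card
    by (intro strict_mono_onI) auto
  have img: "x ` {1..?l} = T"
  proof -
    have "x ` {1..?l} = (\<lambda>i. sorted_list_of_set T ! i) ` ((\<lambda>i. i - 1) ` {1..?l})"
      by (auto simp: x_def image_image)
    also have "(\<lambda>i. i - 1) ` {1..?l} = {0..<?l}"
      by (auto simp: image_iff intro!: bexI[of _ "Suc _"])
    also have "(\<lambda>i. sorted_list_of_set T ! i) ` {0..<?l} = set (sorted_list_of_set T)"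
      using card by (auto simp: set_conv_nth)
    finally show ?thesis using fin by simp
  qed
  have bounds: "x 1 \<le> t" "t \<le> x ?l" if "t \<in> T" for t
  proof -
    from that img obtain i where i: "i \<in> {1..?l}" "t = x i" by blast
    then show "x 1 \<le> t" "t \<le> x ?l"
      using strict_mono_on_leD[OF mono, of 1 i] strict_mono_on_leD[OF mono, of i ?l] by auto
  qed
  have xT: "x 1 \<in> T" "x ?l \<in> T" using img l by auto
  have "x ?l = 1"
    using bounds(2)[of 1] xT T01 node_setD(3)[OF T] by (intro antisym) auto
  moreover have "x 1 = 0" if "odd d"
    using bounds(1)[of 0] xT T01 fixed that by (intro antisym) (auto simp: fixed_nodes_def)
  moreover have "(\<Sum>i = 1..?l. g (x i) * x i ^ m) = (M(0 := 1)) m" if "m \<le> d" for m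
  proof -
    have "(\<Sum>i = 1..?l. g (x i) * x i ^ m) = (\<Sum>t\<in>x ` {1..?l}. g t * t ^ m)"
      using strict_mono_on_imp_inj_on[OF mono] by (simp add: sum.reindex)
    then show ?thesis using mom[OF that] img by simp
  qed
  ultimately have "moment_representation d M (\<lambda>i. g (x i)) x"
    using mono xT T01 g img by (auto simp: moment_representation_def Let_def)
  then show ?thesis using img by blast
qed

subsection \<open>Extremality of higher moments\<close>

text \<open>Listing the roots with multiplicity brings the node polynomial into the form that
  \<open>division_by_nonneg_roots\<close> divides by.\<close>

lemma node_poly_as_list:
  assumes "finite T"
  shows "\<exists>ts. node_poly d T = (\<Prod>t\<leftarrow>ts. [:-t, 1:]) \<and> set ts \<subseteq> T \<and>
    length ts = (\<Sum>t\<in>T. node_mult d t)"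
  using assms
proof (induction T)
  case empty
  show ?case by (intro exI[of _ "[]"]) (simp add: node_poly_def)
next
  case (insert t T)
  then obtain ts where ts: "node_poly d T = (\<Prod>t\<leftarrow>ts. [:-t, 1:])" "set ts \<subseteq> T"
      "length ts = (\<Sum>t\<in>T. node_mult d t)"
    by blast
  have "node_poly d (insert t T) = (\<Prod>t\<leftarrow>replicate (node_mult d t) t @ ts. [:-t, 1:])"
    using insert.hyps ts(1) by (simp add: node_poly_def prod_list_replicate)
  then show ?case
    using ts insert.hyps by (intro exI[of _ "replicate (node_mult d t) t @ ts"]) auto
qed

text \<open>After division of \<open>x ^ k\<close> by the node polynomial, the remainder has degree
  at most \<open>d\<close> and the same integral for \<open>F\<close> and \<open>G\<close>. The
  other part is nonpositive on the unit interval, since \<open>q\<close> has nonnegative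
  coefficients, and vanishes on \<open>T\<close>.\<close>

lemma integral_power_le_node_set:
  assumes F: "F \<in> moment_class d M"
    and G: "G \<in> moment_class d M" "node_set d T" "AE x in G. x \<in> T"
  shows "(\<integral>x. x ^ k \<partial>F) \<le> (\<integral>x. x ^ k \<partial>G)"
proof -
  note uF = moment_classD(1)[OF F] and uG = moment_classD(1)[OF G(1)]
  note T = node_setD[OF G(2)]
  obtain ts where ts: "node_poly d T = (\<Prod>t\<leftarrow>ts. [:-t, 1:])" "set ts \<subseteq> T"
      "length ts = Suc d"
    using node_poly_as_list[OF T(1), of d] degree_node_poly[OF G(2)]
      degree_node_poly_subset[OF T(1), of d] by metis
  have "\<And>t. t \<in> set ts \<Longrightarrow> 0 \<le> t" using ts(2) T(2) by auto
  moreover have "0 \<le> coeff (monom 1 k :: real poly) i" for i by simp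
  ultimately obtain q r where qr: "monom 1 k = node_poly d T * q + r" "\<And>i. 0 \<le> coeff q i"
      "r = 0 \<or> degree r < Suc d"
    using division_by_nonneg_roots[of "monom 1 k" ts] ts by metis
  have "degree r \<le> d" using qr(3) by auto
  have int: "(\<integral>x. x ^ k \<partial>H) = (\<integral>x. poly (node_poly d T * q) x \<partial>H) + (\<integral>x. poly r x \<partial>H)"
    if "H \<in> unit_distributions" for H
  proof -
    have "(\<integral>x. x ^ k \<partial>H) = (\<integral>x. poly (monom 1 k) x \<partial>H)"
      by (simp add: poly_monom)
    also have "\<dots> = (\<integral>x. poly (node_poly d T * q) x + poly r x \<partial>H)"
      unfolding qr(1) poly_add ..
    also have "\<dots> = (\<integral>x. poly (node_poly d T * q) x \<partial>H) + (\<integral>x. poly r x \<partial>H)"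
      using that by (intro Bochner_Integration.integral_add integrable_poly)
    finally show ?thesis .
  qed
  have "0 \<le> poly q x" if "x \<in> {0..1}" for x
    using that qr(2) by (auto simp: poly_altdef intro!: sum_nonneg)
  then have "(\<integral>x. poly (node_poly d T * q) x \<partial>F) \<le> 0"
    using poly_node_poly_nonpos[OF T(1,3)]
    by (intro integral_poly_nonpos[OF uF]) (auto intro: mult_nonpos_nonneg)
  moreover have "(\<integral>x. poly (node_poly d T * q) x \<partial>G) = 0"
    using integral_finite_support[OF uG T(1) G(3), of "poly (node_poly d T * q)"]
      poly_node_poly_eq_0[OF T(1), of d] by (simp add: sum.neutral)
  ultimately show ?thesis
    using int[OF uF] int[OF uG] moment_class_integral_poly[OF F G(1) \<open>degree r \<le> d\<close>] by linarith
qed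

text \<open>The node polynomial has degree \<open>d + 1\<close>, so one further common moment makes
  its integral zero under \<open>F\<close> too, which confines \<open>F\<close> to
  \<open>T\<close>.\<close>

lemma next_moment_determines:
  assumes "d \<ge> 1" and F: "F \<in> moment_class d M"
    and G: "G \<in> moment_class d M" "node_set d T" "AE x in G. x \<in> T"
    and eq: "(\<integral>x. x ^ Suc d \<partial>F) = (\<integral>x. x ^ Suc d \<partial>G)"
  shows "F = G"
proof -
  note uF = moment_classD(1)[OF F] and uG = moment_classD(1)[OF G(1)]
  note T = node_setD[OF G(2)]
  have "(\<integral>x. x ^ i \<partial>F) = (\<integral>x. x ^ i \<partial>G)" if "i \<le> Suc d" for i
    using moment_class_integral_power[OF F] moment_class_integral_power[OF G(1)] eq that
    by (cases "i = Suc d") auto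
  then have "(\<integral>x. poly (node_poly d T) x \<partial>F) = (\<integral>x. poly (node_poly d T) x \<partial>G)"
    using uF uG degree_node_poly[OF G(2)] by (simp add: integral_poly del: power_Suc)
  also have "\<dots> = 0"
    using integral_finite_support[OF uG T(1) G(3), of "poly (node_poly d T)"]
      poly_node_poly_eq_0[OF T(1), of d] by (simp add: sum.neutral)
  finally have "AE x in F. poly (node_poly d T) x = 0"
    using uF T poly_node_poly_nonpos by (intro AE_poly_eq_0) auto
  then have "AE x in F. x \<in> T"
    using T(1) by (simp add: poly_node_poly_eq_0)
  then show ?thesis
    using T assms by (intro moment_class_eqI[of F d M G T]) auto
qed

text \<open>Without the factor \<open>x - 1\<close> the node polynomial is nonnegative, of degree at
  most \<open>d\<close>, and still zero wherever \<open>G\<close> has mass. Its integral is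
  therefore zero for every member of the class.\<close>

lemma moment_class_singleton:
  assumes "d \<ge> 1" and F: "F \<in> moment_class d M"
    and G: "G \<in> moment_class d M" "node_set d T" "AE x in G. x \<in> T"
    and no_mass: "measure G {1} = 0"
  shows "F = G"
proof -
  note uF = moment_classD(1)[OF F] and uG = moment_classD(1)[OF G(1)]
  note T = node_setD[OF G(2)]
  let ?R = "node_poly d (T - {1})"
  have zero: "measure G {t} * poly ?R t = 0" if "t \<in> T" for t
    using that no_mass T(1) by (cases "t = 1") (auto simp: poly_node_poly_eq_0)
  have "(\<integral>x. poly ?R x \<partial>F) = (\<integral>x. poly ?R x \<partial>G)"
    using moment_class_integral_poly[OF F G(1) degree_node_poly_remove[OF G(2) T(3)]] .
  also have "\<dots> = 0"
    using integral_finite_support[OF uG T(1) G(3), of "poly ?R"] zero by (simp add: sum.neutral)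
  finally have "AE x in F. poly ?R x = 0"
    using uF T poly_node_poly_nonneg[of "T - {1}"] by (intro AE_poly_eq_0) auto
  then have "AE x in F. x \<in> T"
    using T(1) by (auto simp: poly_node_poly_eq_0 elim!: eventually_mono)
  then show ?thesis
    using T assms by (intro moment_class_eqI[of F d M G T]) auto
qed

text \<open>Termwise integration of the logarithm series, dominated by the geometric series in
  \<open>y\<close>.\<close>

lemma integral_ln_one_minus_sums:
  fixes y :: real
  assumes F: "F \<in> unit_distributions" and y: "0 \<le> y" "y < 1"
  shows "(\<lambda>k. - (y ^ k / real k * (\<integral>x. x ^ k \<partial>F))) sums (\<integral>x. ln (1 - y * x) \<partial>F)"
proof -
  interpret prob_space F by (rule unit_distributionsD[OF F])
  note [measurable_cong] = unit_distributionsD(2)[OF F]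
  note AE = unit_distributionsD(4)[OF F]
  \<comment> \<open>At \<open>k = 0\<close> division by zero gives 0, so the series effectively
    starts at \<open>k = 1\<close>.\<close>
  define h where "h k x = - (y ^ k / real k * x ^ k)" for k x
  have int: "integrable F (h k)" for k
    unfolding h_def using F by simp
  have bound: "norm (h k x) \<le> y ^ k" if "x \<in> {0..1}" for k x
  proof -
    have "norm (h k x) = y ^ k * (x ^ k / real k)"
      using that y by (simp add: h_def abs_mult power_abs)
    moreover have "x ^ k / real k \<le> 1"
    proof (cases "k = 0")
      case False
      then have "1 \<le> real k" by simp
      moreover have "x ^ k \<le> 1" using that by (intro power_le_one) auto
      ultimately show ?thesis by (simp add: divide_le_eq)
    qed simp
    ultimately show ?thesis
      using mult_left_le[of "x ^ k / real k" "y ^ k"] y by simp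
  qed
  have sy: "summable (\<lambda>k. y ^ k)"
    using y by (intro summable_geometric) auto
  have "(\<lambda>k. \<integral>x. h k x \<partial>F) sums (\<integral>x. (\<Sum>k. h k x) \<partial>F)"
  proof (rule sums_integral)
    show "AE x in F. summable (\<lambda>k. norm (h k x))"
      using AE
    proof eventually_elim
      case (elim x)
      show ?case
        using bound[OF elim] by (intro summable_comparison_test[OF _ sy]) auto
    qed
    have "(\<integral>x. norm (h k x) \<partial>F) \<le> y ^ k" for k
    proof -
      have "AE x in F. norm (h k x) \<le> y ^ k" using AE bound by auto
      then have "(\<integral>x. norm (h k x) \<partial>F) \<le> (\<integral>x. y ^ k \<partial>F)"
        using int by (intro integral_mono_AE) auto
      then show ?thesis by (simp add: prob_space)
    qed
    then show "summable (\<lambda>k. \<integral>x. norm (h k x) \<partial>F)"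
      by (intro summable_comparison_test[OF _ sy]) auto
  qed (rule int)
  also have "(\<integral>x. (\<Sum>k. h k x) \<partial>F) = (\<integral>x. ln (1 - y * x) \<partial>F)"
  proof (rule integral_cong_AE)
    show "AE x in F. (\<Sum>k. h k x) = ln (1 - y * x)"
      using AE
    proof eventually_elim
      case (elim x)
      have "\<bar>- (y * x)\<bar> < 1"
        using y elim by (auto simp: abs_mult intro: mult_le_one order.strict_trans1[OF mult_left_le])
      from ln_series'[OF this] have "(\<lambda>k. h k x) sums ln (1 - y * x)"
        by (simp add: h_def power_mult_distrib)
      then show ?case by (rule sums_unique[symmetric])
    qed
  qed (unfold h_def, measurable)
  also have "(\<lambda>k. \<integral>x. h k x \<partial>F) = (\<lambda>k. - (y ^ k / real k * (\<integral>x. x ^ k \<partial>F)))"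
    unfolding h_def by simp
  finally show ?thesis .
qed

text \<open>The difference of the two integrals is a series of nonnegative multiples of moment
  differences. If it is zero, so is its term at \<open>d + 1\<close>, whose factor is positive
  because \<open>0 < y\<close>.\<close>

lemma integral_ln_node_set:
  fixes y :: real
  assumes "d \<ge> 1" and F: "F \<in> moment_class d M"
    and G: "G \<in> moment_class d M" "node_set d T" "AE x in G. x \<in> T"
    and y: "0 < y" "y < 1"
  shows "(\<integral>x. ln (1 - y * x) \<partial>G) \<le> (\<integral>x. ln (1 - y * x) \<partial>F)" (is ?le)
    and "(\<integral>x. ln (1 - y * x) \<partial>G) = (\<integral>x. ln (1 - y * x) \<partial>F) \<Longrightarrow> F = G"
proof -
  note uF = moment_classD(1)[OF F] and uG = moment_classD(1)[OF G(1)]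
  define a where "a k = y ^ k / real k * ((\<integral>x. x ^ k \<partial>G) - (\<integral>x. x ^ k \<partial>F))" for k
  have a_nn: "0 \<le> a k" for k
    unfolding a_def using y integral_power_le_node_set[OF F G] by simp
  have "0 \<le> y" using y by simp
  have "a = (\<lambda>k. - (y ^ k / real k * (\<integral>x. x ^ k \<partial>F)) - - (y ^ k / real k * (\<integral>x. x ^ k \<partial>G)))"
    by (simp add: a_def fun_eq_iff algebra_simps)
  then have a_sums: "a sums ((\<integral>x. ln (1 - y * x) \<partial>F) - (\<integral>x. ln (1 - y * x) \<partial>G))"
    using sums_diff[OF integral_ln_one_minus_sums[OF uF \<open>0 \<le> y\<close> y(2)]
      integral_ln_one_minus_sums[OF uG \<open>0 \<le> y\<close> y(2)]] by simp
  have "0 \<le> (\<integral>x. ln (1 - y * x) \<partial>F) - (\<integral>x. ln (1 - y * x) \<partial>G)"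
    using sums_le[OF a_nn sums_zero a_sums] .
  then show ?le by simp
  assume "(\<integral>x. ln (1 - y * x) \<partial>G) = (\<integral>x. ln (1 - y * x) \<partial>F)"
  then have "suminf a = 0"
    using sums_unique[OF a_sums] by simp
  then have "a (Suc d) = 0"
    using suminf_eq_zero_iff[OF sums_summable[OF a_sums] a_nn] by simp
  then have "(\<integral>x. x ^ Suc d \<partial>F) = (\<integral>x. x ^ Suc d \<partial>G)"
    using y by (simp add: a_def del: power_Suc of_nat_Suc)
  then show "F = G" by (rule next_moment_determines[OF assms(1) F G])
qed

subsection \<open>Duality for the divergence minimisation\<close>

text \<open>With \<open>D\<close> the density of \<open>F\<close> with respect to \<open>G\<close>,
  the inequality \<open>ln z \<le> z - 1\<close> at \<open>z = \<phi> / D\<close> is integrated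
  against \<open>F\<close>; the integral of \<open>\<phi> / D\<close> is at most that of
  \<open>\<phi>\<close> under \<open>G\<close>.\<close>

lemma KL_ge_integral_ln:
  fixes \<phi> :: "real \<Rightarrow> real"
  assumes F: "F \<in> unit_distributions" and G: "G \<in> unit_distributions"
    and \<phi>: "continuous_on UNIV \<phi>" "\<And>x. x \<in> {0..1} \<Longrightarrow> 0 < \<phi> x"
    and le1: "(\<integral>x. \<phi> x \<partial>G) \<le> 1"
  shows "ereal (\<integral>x. ln (\<phi> x) \<partial>F) \<le> KL F G"
proof (cases "absolutely_continuous G F \<and> integrable F (entropy_density (exp 1) G F)")
  case False
  then have "KL F G = \<infinity>" unfolding KL_def by (rule if_not_P)
  then show ?thesis by simp
next
  case True
  then have ac: "absolutely_continuous G F"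
    and int: "integrable F (entropy_density (exp 1) G F)" by auto
  interpret F: prob_space F by (rule unit_distributionsD[OF F])
  interpret G: prob_space G by (rule unit_distributionsD[OF G])
  note sF [measurable_cong] = unit_distributionsD(2)[OF F]
  note sG [measurable_cong] = unit_distributionsD(2)[OF G]
  have \<phi>_m [measurable]: "\<phi> \<in> borel_measurable borel"
    using \<phi>(1) by (rule borel_measurable_continuous_onI)
  have \<phi>_c: "continuous_on {0..1} \<phi>" using \<phi>(1) continuous_on_subset by blast
  obtain D where D_m: "D \<in> borel_measurable G"
      and D_eq: "AE x in G. RN_deriv G F x = ennreal (D x)"
      and D_pos: "AE x in F. 0 < D x" and D_nn: "\<And>x. 0 \<le> D x"
    using G.real_RN_deriv[OF F.finite_measure_axioms ac] sF sG by metis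
  have [measurable]: "D \<in> borel_measurable borel"
    using D_m by measurable
  have F_eq: "F = density G D"
  proof -
    have "F = density G (RN_deriv G F)"
      using G.density_RN_deriv[OF ac] sF sG by simp
    also have "\<dots> = density G D"
      using D_eq by (intro density_cong) auto
    finally show ?thesis .
  qed
  have int_\<phi>G: "integrable G \<phi>"
    using G \<phi>_m \<phi>_c by (rule integrable_unit_distribution)
  have posG: "AE x in G. 0 < \<phi> x" and posF: "AE x in F. 0 < \<phi> x"
    using unit_distributionsD(4)[OF G] unit_distributionsD(4)[OF F] \<phi>(2) by auto
  have int_ln: "integrable F (\<lambda>x. ln (\<phi> x))"
  proof (rule integrable_unit_distribution[OF F])
    show "continuous_on {0..1} (\<lambda>x. ln (\<phi> x))"
      using \<phi>_c \<phi>(2) by (intro continuous_on_ln) (auto simp: less_imp_neq[symmetric])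
  qed measurable
  have ent: "AE x in F. entropy_density (exp 1) G F x = ln (D x)"
    using absolutely_continuous_AE[OF _ ac D_eq] sF sG D_nn
    by (auto simp: entropy_density_def log_def elim!: eventually_mono)
  have int_lnD: "integrable F (\<lambda>x. ln (D x))"
    using int ent by (subst integrable_cong_AE[of _ _ "entropy_density (exp 1) G F"])
      (auto simp: borel_measurable_integrable)
  \<comment> \<open>Where \<open>D\<close> vanishes the product is 0 instead of
    \<open>\<phi> x\<close>; this is why only an inequality between the integrals results.\<close>
  have bound: "AE x in G. norm (D x * (\<phi> x / D x)) \<le> norm (\<phi> x)"
    by auto
  have int_G: "integrable G (\<lambda>x. D x * (\<phi> x / D x))"
    by (rule Bochner_Integration.integrable_bound[OF int_\<phi>G _ bound]) measurable
  then have int_ratio: "integrable F (\<lambda>x. \<phi> x / D x)"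
    unfolding F_eq using D_nn by (subst integrable_density) auto
  have "(\<integral>x. \<phi> x / D x \<partial>F) = (\<integral>x. D x * (\<phi> x / D x) \<partial>G)"
    by (subst (1) F_eq, subst integral_density) (use D_nn in auto)
  also have "\<dots> \<le> (\<integral>x. \<phi> x \<partial>G)"
    using int_G int_\<phi>G posG by (intro integral_mono_AE) (auto elim!: eventually_mono)
  finally have ratio: "(\<integral>x. \<phi> x / D x \<partial>F) \<le> 1" using le1 by linarith
  have "AE x in F. ln (\<phi> x) \<le> ln (D x) + (\<phi> x / D x - 1)"
    using D_pos posF
  proof eventually_elim
    case (elim x)
    then show ?case
      using ln_le_minus_one[of "\<phi> x / D x"] by (simp add: ln_div)
  qed
  then have "(\<integral>x. ln (\<phi> x) \<partial>F) \<le> (\<integral>x. ln (D x) + (\<phi> x / D x - 1) \<partial>F)"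
    using int_ln int_lnD int_ratio by (intro integral_mono_AE) auto
  also have "\<dots> = (\<integral>x. ln (D x) \<partial>F) + ((\<integral>x. \<phi> x / D x \<partial>F) - 1)"
    using int_lnD int_ratio by (simp add: F.prob_space)
  also have "\<dots> \<le> (\<integral>x. ln (D x) \<partial>F)" using ratio by simp
  also have "\<dots> = KL_divergence (exp 1) G F"
    unfolding KL_divergence_def using ent int int_lnD
    by (intro integral_cong_AE) (auto simp: borel_measurable_integrable elim!: eventually_mono)
  finally show ?thesis using True by (simp add: KL_def)
qed

section \<open>Linear dual densities and comparison over the moment class\<close>

lemma dual_density_pos:
  fixes \<mu> \<nu> x :: real
  assumes "0 \<le> \<mu>" "0 \<le> \<nu>" "\<nu> * (1 - \<mu>) < 1" "x \<in> {0..1}"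
  shows "0 < 1 - \<nu> * (x - \<mu>)"
proof -
  have "\<nu> * (x - \<mu>) \<le> \<nu> * (1 - \<mu>)"
    using assms by (intro mult_left_mono) auto
  then show ?thesis using assms(3) by linarith
qed

text \<open>Weak duality: for \<open>\<nu> \<ge> 0\<close> the mean constraint on \<open>G\<close>
  is exactly what bounds the integral of \<open>1 - \<nu> * (x - \<mu>)\<close> by 1.\<close>

lemma D_min_ge:
  assumes F: "F \<in> unit_distributions" and \<nu>: "0 \<le> \<mu>" "0 \<le> \<nu>" "\<nu> * (1 - \<mu>) < 1"
  shows "ereal (\<integral>x. ln (1 - \<nu> * (x - \<mu>)) \<partial>F) \<le> D_min F \<mu>"
  unfolding D_min_def
proof (rule INF_greatest, safe)
  fix G assume G: "G \<in> unit_distributions" and mean: "\<mu> \<le> (\<integral>x. x \<partial>G)"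
  interpret prob_space G by (rule unit_distributionsD[OF G])
  have "integrable G (\<lambda>x. x)"
    using integrable_power_unit_distribution[OF G, of 1] by simp
  then have "(\<integral>x. 1 - \<nu> * (x - \<mu>) \<partial>G) = 1 - \<nu> * ((\<integral>x. x \<partial>G) - \<mu>)"
    by (simp add: prob_space)
  also have "\<dots> \<le> 1" using mean \<nu> by simp
  finally show "ereal (\<integral>x. ln (1 - \<nu> * (x - \<mu>)) \<partial>F) \<le> KL F G"
    using dual_density_pos[OF \<nu>]
    by (intro KL_ge_integral_ln[OF F G]) (auto intro!: continuous_intros)
qed

text \<open>The witness has density \<open>1 / (1 - \<nu> * (x - \<mu>))\<close> with respect to
  \<open>F\<close>. \<open>mass\<close> and \<open>mean\<close> make it feasible, and its divergence
  is the dual value.\<close>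

lemma D_min_le:
  assumes F: "F \<in> unit_distributions" and \<nu>: "0 \<le> \<mu>" "0 \<le> \<nu>" "\<nu> * (1 - \<mu>) < 1"
    and mass: "(\<integral>x. 1 / (1 - \<nu> * (x - \<mu>)) \<partial>F) = 1"
    and mean: "\<mu> \<le> (\<integral>x. x / (1 - \<nu> * (x - \<mu>)) \<partial>F)"
  shows "D_min F \<mu> \<le> ereal (\<integral>x. ln (1 - \<nu> * (x - \<mu>)) \<partial>F)"
proof -
  interpret F: prob_space F by (rule unit_distributionsD[OF F])
  note sF [measurable_cong] = unit_distributionsD(2)[OF F]
  define \<phi> where "\<phi> x = 1 - \<nu> * (x - \<mu>)" for x
  have [measurable]: "\<phi> \<in> borel_measurable borel"
    unfolding \<phi>_def by measurable
  have pos: "0 < \<phi> x" if "x \<in> {0..1}" for x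
    unfolding \<phi>_def by (rule dual_density_pos[OF \<nu> that])
  have posF: "AE x in F. 0 < \<phi> x"
    using unit_distributionsD(4)[OF F] pos by auto
  have \<phi>_c: "continuous_on {0..1} \<phi>"
    unfolding \<phi>_def by (intro continuous_intros)
  have int: "integrable F (\<lambda>x. 1 / \<phi> x)"
  proof (rule integrable_unit_distribution[OF F])
    show "continuous_on {0..1} (\<lambda>x. 1 / \<phi> x)"
      using \<phi>_c pos by (intro continuous_intros) (auto simp: less_imp_neq[symmetric])
  qed measurable
  define G where "G = density F (\<lambda>x. ennreal (1 / \<phi> x))"
  have sG [measurable_cong]: "sets G = sets borel" by (simp add: G_def sF)
  have "emeasure G (space G) = (\<integral>\<^sup>+x. ennreal (1 / \<phi> x) \<partial>F)"
    unfolding G_def by (simp add: emeasure_density cong: nn_integral_cong)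
  also have "\<dots> = ennreal (\<integral>x. 1 / \<phi> x \<partial>F)"
    using int posF by (intro nn_integral_eq_integral) (auto elim!: eventually_mono)
  finally have "prob_space G"
    using mass by (intro prob_spaceI) (simp add: \<phi>_def)
  then interpret G: prob_space G .
  have "AE x in F. 0 < ennreal (1 / \<phi> x) \<longrightarrow> x \<in> {0..1}"
    using unit_distributionsD(4)[OF F] by eventually_elim simp
  then have "AE x in G. x \<in> {0..1}"
    unfolding G_def by (subst AE_density) measurable
  then have uG: "G \<in> unit_distributions"
    using G.prob_space_axioms sG
    by (simp add: unit_distributions_def real_distribution_def real_distribution_axioms_def)
  have "(\<integral>x. x \<partial>G) = (\<integral>x. 1 / \<phi> x * x \<partial>F)"
    unfolding G_def using posF by (subst integral_density) (auto elim!: eventually_mono)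
  also have "\<dots> = (\<integral>x. x / (1 - \<nu> * (x - \<mu>)) \<partial>F)"
    by (simp add: \<phi>_def)
  finally have meanG: "\<mu> \<le> (\<integral>x. x \<partial>G)" using mean by simp
  \<comment> \<open>Inverting the density recovers \<open>F\<close>; uniqueness of Radon-Nikodym
    derivatives then identifies \<open>RN_deriv G F\<close> with \<open>\<phi>\<close>.\<close>
  have F_eq: "density G (\<lambda>x. ennreal (\<phi> x)) = F"
  proof -
    have "density G (\<lambda>x. ennreal (\<phi> x)) = density F (\<lambda>x. ennreal (1 / \<phi> x) * ennreal (\<phi> x))"
      unfolding G_def by (intro density_density_eq) measurable
    also have "\<dots> = density F (\<lambda>_. 1)"
      using posF
      by (intro density_cong) (auto simp: ennreal_mult''[symmetric] elim!: eventually_mono)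
    finally show ?thesis by (simp add: density_1)
  qed
  have ac: "absolutely_continuous G F"
    by (subst F_eq[symmetric], rule absolutely_continuousI_density) measurable
  have "AE x in G. ennreal (\<phi> x) = RN_deriv G F x"
    using F_eq by (intro G.RN_deriv_unique) measurable
  then have RN: "AE x in F. ennreal (\<phi> x) = RN_deriv G F x"
    using absolutely_continuous_AE[OF _ ac] sF sG by simp
  have ent: "AE x in F. ln (\<phi> x) = entropy_density (exp 1) G F x"
    using RN posF
  proof eventually_elim
    case (elim x)
    then show ?case by (simp add: entropy_density_def log_def flip: elim(1))
  qed
  have ent_m [measurable]: "entropy_density (exp 1) G F \<in> borel_measurable F"
    using measurable_entropy_density[of "exp 1" G F] sF sG measurable_cong_sets by blast
  have int_ln: "integrable F (\<lambda>x. ln (\<phi> x))"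
  proof (rule integrable_unit_distribution[OF F])
    show "continuous_on {0..1} (\<lambda>x. ln (\<phi> x))"
      using \<phi>_c pos by (intro continuous_on_ln) (auto simp: less_imp_neq[symmetric])
  qed measurable
  have "integrable F (entropy_density (exp 1) G F)"
    using int_ln ent by (subst integrable_cong_AE[of _ _ "\<lambda>x. ln (\<phi> x)"]) auto
  moreover have "KL_divergence (exp 1) G F = (\<integral>x. ln (\<phi> x) \<partial>F)"
    unfolding KL_divergence_def using ent
    by (intro integral_cong_AE) (auto elim!: eventually_mono)
  ultimately have "KL F G = ereal (\<integral>x. ln (\<phi> x) \<partial>F)"
    using ac by (simp add: KL_def)
  then show ?thesis
    unfolding D_min_def \<phi>_def using uG meanG by (auto intro!: INF_lower2[of G])
qed

text \<open>At the multiplier \<open>\<nu> = 0\<close> both duality bounds are the integral of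
  \<open>ln 1\<close>; the witness is \<open>F\<close> itself.\<close>

lemma D_min_eq_0:
  assumes F: "F \<in> unit_distributions" and "0 \<le> \<mu>" "\<mu> \<le> (\<integral>x. x \<partial>F)"
  shows "D_min F \<mu> = 0"
proof -
  interpret prob_space F by (rule unit_distributionsD[OF F])
  show ?thesis
    using D_min_ge[OF F, of \<mu> 0] D_min_le[OF F, of \<mu> 0] assms
    by (intro antisym) (auto simp: prob_space zero_ereal_def)
qed

text \<open>On the unit interval, mean at least 1 forces all mass to 1, and \<open>F\<close> is not
  absolutely continuous with respect to that point mass.\<close>

lemma D_min_1_eq_infinity:
  assumes F: "F \<in> unit_distributions" and mean: "(\<integral>x. x \<partial>F) < 1"
  shows "D_min F 1 = \<infinity>"
proof -
  have "KL F G = \<infinity>" if G: "G \<in> unit_distributions" "1 \<le> (\<integral>x. x \<partial>G)" for G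
  proof (rule ccontr)
    assume "KL F G \<noteq> \<infinity>"
    then have ac: "absolutely_continuous G F"
      unfolding KL_def by (auto split: if_splits)
    interpret F: prob_space F by (rule unit_distributionsD[OF F])
    interpret G: prob_space G by (rule unit_distributionsD[OF G(1)])
    have "(\<integral>x. poly [:1, -1:] x \<partial>G) = 1 - (\<integral>x. x \<partial>G)"
      using integrable_power_unit_distribution[OF G(1), of 1] by (simp add: G.prob_space)
    moreover have "0 \<le> (\<integral>x. poly [:1, -1:] x \<partial>G)"
      by (rule integral_poly_nonneg[OF G(1)]) simp
    ultimately have "(\<integral>x. poly [:1, -1:] x \<partial>G) = 0" using G(2) by simp
    then have "AE x in G. poly [:1, -1:] x = 0"
      by (intro AE_poly_eq_0[OF G(1)]) auto
    then have "AE x in F. poly [:1, -1:] x = 0"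
      using absolutely_continuous_AE[OF _ ac] F G by (simp add: unit_distributionsD)
    then have one: "AE x in F. x = 1" by simp
    note [measurable_cong] = unit_distributionsD(2)[OF F]
    have "(\<integral>x. x \<partial>F) = (\<integral>x. 1 \<partial>F)"
      by (rule integral_cong_AE[OF _ _ one]) measurable
    then show False using mean by (simp add: F.prob_space)
  qed
  then have "\<infinity> \<le> D_min F 1"
    unfolding D_min_def by (intro INF_greatest) simp
  then show ?thesis by simp
qed

text \<open>The optimal multiplier solves $E_F[(X - \mu) / (1 - \nu (X - \mu))] = 0$. The mass at 1 makes
  the left-hand side nonnegative before \<open>\<nu>\<close> reaches $1 / (1 - \mu)$.\<close>

lemma dual_optimum_exists:
  assumes F: "F \<in> unit_distributions" and T: "finite T" "T \<subseteq> {0..1}" "1 \<in> T" "AE x in F. x \<in> T"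
    and mass: "measure F {1} > 0" and \<mu>: "0 \<le> \<mu>" "(\<integral>x. x \<partial>F) < \<mu>" "\<mu> < 1"
  shows "\<exists>\<nu>. 0 < \<nu> \<and> \<nu> * (1 - \<mu>) < 1 \<and> (\<integral>x. 1 / (1 - \<nu> * (x - \<mu>)) \<partial>F) = 1 \<and>
    (\<integral>x. x / (1 - \<nu> * (x - \<mu>)) \<partial>F) = \<mu>"
proof -
  interpret prob_space F by (rule unit_distributionsD[OF F])
  define g where "g t = measure F {t}" for t
  have g_nn: "0 \<le> g t" for t by (simp add: g_def)
  note int = integral_finite_support[OF F T(1,4), folded g_def]
  have g_sum: "(\<Sum>t\<in>T. g t) = 1"
    using int[of "\<lambda>_. 1"] by (simp add: prob_space)
  have g_mean: "(\<Sum>t\<in>T. g t * t) < \<mu>"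
    using int[of "\<lambda>x. x"] \<mu>(2) by simp
  define \<psi> where "\<psi> \<nu> = (\<Sum>t\<in>T. g t * ((t - \<mu>) / (1 - \<nu> * (t - \<mu>))))" for \<nu>
  \<comment> \<open>At \<open>\<nu> = b\<close> the denominator at 1 equals
    \<open>\<epsilon>\<close>, so the atom at 1 contributes exactly 1 to \<open>\<psi> b\<close>.
    Every other node contributes at least minus its mass, in total at least \<open>g 1 - 1\<close>,
    whence \<open>\<psi> b \<ge> 0\<close>.\<close>
  define \<epsilon> where "\<epsilon> = g 1 * (1 - \<mu>)"
  define b where "b = (1 - \<epsilon>) / (1 - \<mu>)"
  have "0 < g 1" "g 1 \<le> 1" using mass by (auto simp: g_def)
  then have \<epsilon>: "0 < \<epsilon>" "\<epsilon> \<le> 1"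
    unfolding \<epsilon>_def using \<mu> by (auto intro: mult_le_one)
  have b: "0 \<le> b" "b * (1 - \<mu>) = 1 - \<epsilon>"
    using \<epsilon> \<mu> by (auto simp: b_def)
  have pos: "0 < 1 - \<nu> * (t - \<mu>)" if "0 \<le> \<nu>" "\<nu> \<le> b" "t \<in> T" for \<nu> t
  proof (rule dual_density_pos[OF \<mu>(1) that(1)])
    have "\<nu> * (1 - \<mu>) \<le> b * (1 - \<mu>)" using that(2) \<mu>(3) by (intro mult_right_mono) auto
    then show "\<nu> * (1 - \<mu>) < 1" using b \<epsilon> by linarith
  qed (use that T(2) in auto)
  have "\<psi> 0 = (\<Sum>t\<in>T. g t * t) - (\<Sum>t\<in>T. g t) * \<mu>"
    by (simp add: \<psi>_def right_diff_distrib sum_subtractf sum_distrib_right)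
  then have \<psi>0: "\<psi> 0 < 0"
    using g_sum g_mean by simp
  have "0 \<le> \<psi> b"
  proof -
    have "g t * -1 \<le> g t * ((t - \<mu>) / (1 - b * (t - \<mu>)))" if t: "t \<in> T - {1}" for t
    proof (rule mult_left_mono[OF _ g_nn])
      have p: "0 < 1 - b * (t - \<mu>)" using pos[of b t] b(1) t by simp
      have "- (1 - b * (t - \<mu>)) \<le> t - \<mu>"
      proof (cases "t \<ge> \<mu>")
        case True
        then show ?thesis using p by linarith
      next
        case False
        then have "b * (t - \<mu>) \<le> 0" using b(1) by (simp add: mult_nonneg_nonpos)
        moreover have "-1 \<le> t - \<mu>" using t T(2) \<mu>(3) by auto
        ultimately show ?thesis by linarith
      qed
      then show "-1 \<le> (t - \<mu>) / (1 - b * (t - \<mu>))"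
        using p by (subst le_divide_eq) simp
    qed
    then have "(\<Sum>t\<in>T - {1}. g t * -1) \<le> (\<Sum>t\<in>T - {1}. g t * ((t - \<mu>) / (1 - b * (t - \<mu>))))"
      by (rule sum_mono)
    moreover have "(\<Sum>t\<in>T - {1}. g t) = 1 - g 1"
      using g_sum T(1,3) by (simp add: sum_diff1)
    moreover have "g 1 * ((1 - \<mu>) / (1 - b * (1 - \<mu>))) = 1"
      using b(2) \<open>0 < g 1\<close> \<mu>(3) by (simp add: \<epsilon>_def)
    moreover have "\<psi> b = g 1 * ((1 - \<mu>) / (1 - b * (1 - \<mu>)))
        + (\<Sum>t\<in>T - {1}. g t * ((t - \<mu>) / (1 - b * (t - \<mu>))))"
      unfolding \<psi>_def using T(1,3) by (rule sum.remove)
    ultimately show ?thesis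
      using \<open>0 < g 1\<close> \<mu>(3) by (simp add: sum_negf)
  qed
  moreover have "continuous_on {0..b} \<psi>"
    unfolding \<psi>_def using pos
    by (intro continuous_intros) (auto simp: less_imp_neq[symmetric])
  ultimately obtain \<nu> where \<nu>: "0 \<le> \<nu>" "\<nu> \<le> b" "\<psi> \<nu> = 0"
    using IVT'[of \<psi> 0 0 b] \<psi>0 b(1) by auto
  have "\<nu> \<noteq> 0" using \<nu>(3) \<psi>0 by auto
  have "\<nu> * (1 - \<mu>) \<le> b * (1 - \<mu>)" using \<nu>(2) \<mu>(3) by (intro mult_right_mono) auto
  then have lt: "\<nu> * (1 - \<mu>) < 1" using b \<epsilon> by linarith
  \<comment> \<open>From \<open>1 / (1 - z) = 1 + z / (1 - z)\<close> the total mass is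
    \<open>1 + \<nu> * \<psi> \<nu>\<close>, so a zero of \<open>\<psi>\<close> normalises the
    density. The mean then follows by writing \<open>t = (t - \<mu>) + \<mu>\<close>.\<close>
  have mass1: "(\<Sum>t\<in>T. g t * (1 / (1 - \<nu> * (t - \<mu>)))) = 1"
  proof -
    have "(\<Sum>t\<in>T. g t * (1 / (1 - \<nu> * (t - \<mu>))))
        = (\<Sum>t\<in>T. g t + \<nu> * (g t * ((t - \<mu>) / (1 - \<nu> * (t - \<mu>)))))"
    proof (rule sum.cong[OF refl])
      fix t assume "t \<in> T"
      then have "1 - \<nu> * (t - \<mu>) \<noteq> 0" using pos[OF \<nu>(1,2), of t] by auto
      then have "1 / (1 - \<nu> * (t - \<mu>)) = 1 + \<nu> * ((t - \<mu>) / (1 - \<nu> * (t - \<mu>)))"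
        by (simp add: divide_simps)
      then show "g t * (1 / (1 - \<nu> * (t - \<mu>)))
          = g t + \<nu> * (g t * ((t - \<mu>) / (1 - \<nu> * (t - \<mu>))))"
        by (simp only: distrib_left mult_1_right mult.left_commute)
    qed
    also have "\<dots> = (\<Sum>t\<in>T. g t) + \<nu> * \<psi> \<nu>"
      by (simp only: sum.distrib sum_distrib_left \<psi>_def)
    finally show ?thesis using g_sum \<nu>(3) by simp
  qed
  have "(\<integral>x. 1 / (1 - \<nu> * (x - \<mu>)) \<partial>F) = 1"
    using mass1 by (subst int) auto
  moreover have "(\<integral>x. x / (1 - \<nu> * (x - \<mu>)) \<partial>F) = \<mu>"
  proof -
    have "(\<integral>x. x / (1 - \<nu> * (x - \<mu>)) \<partial>F) = (\<Sum>t\<in>T. g t * (t / (1 - \<nu> * (t - \<mu>))))"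
      by (subst int) auto
    also have "\<dots> = (\<Sum>t\<in>T. g t * ((t - \<mu>) / (1 - \<nu> * (t - \<mu>)))
        + \<mu> * (g t * (1 / (1 - \<nu> * (t - \<mu>)))))"
      by (intro sum.cong refl) (simp add: diff_divide_distrib algebra_simps)
    also have "\<dots> = \<psi> \<nu> + \<mu> * (\<Sum>t\<in>T. g t * (1 / (1 - \<nu> * (t - \<mu>))))"
      by (simp only: sum.distrib sum_distrib_left \<psi>_def)
    finally show ?thesis using mass1 \<nu>(3) by simp
  qed
  ultimately show ?thesis
    using \<nu>(1) \<open>\<nu> \<noteq> 0\<close> lt by (intro exI[of _ \<nu>]) auto
qed

text \<open>Factoring out \<open>1 + \<nu> * \<mu>\<close> reduces the dual density to the form
  \<open>1 - y * x\<close> covered by the power series; the added constant is the same for all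
  distributions.\<close>

lemma integral_ln_dual_density:
  assumes F: "F \<in> unit_distributions" and \<nu>: "0 \<le> \<mu>" "0 \<le> \<nu>" "\<nu> * (1 - \<mu>) < 1"
  shows "(\<integral>x. ln (1 - \<nu> * (x - \<mu>)) \<partial>F)
    = ln (1 + \<nu> * \<mu>) + (\<integral>x. ln (1 - \<nu> / (1 + \<nu> * \<mu>) * x) \<partial>F)"
proof -
  interpret prob_space F by (rule unit_distributionsD[OF F])
  note [measurable_cong] = unit_distributionsD(2)[OF F]
  define a where "a = 1 + \<nu> * \<mu>"
  have "0 < a" using \<nu> by (simp add: a_def add_pos_nonneg)
  have pos: "0 < 1 - \<nu> / a * x" if "x \<in> {0..1}" for x
  proof -
    have "0 < (1 - \<nu> * (x - \<mu>)) / a"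
      using dual_density_pos[OF \<nu> that] \<open>0 < a\<close> by simp
    also have "\<dots> = 1 - \<nu> / a * x"
      using \<open>0 < a\<close> by (simp add: field_simps) (simp add: a_def algebra_simps)
    finally show ?thesis .
  qed
  have split: "ln (1 - \<nu> * (x - \<mu>)) = ln a + ln (1 - \<nu> / a * x)" if "x \<in> {0..1}" for x
  proof -
    have "1 - \<nu> * (x - \<mu>) = a * (1 - \<nu> / a * x)"
      using \<open>0 < a\<close> by (simp add: field_simps) (simp add: a_def algebra_simps)
    then show ?thesis
      using \<open>0 < a\<close> pos[OF that] by (simp add: ln_mult)
  qed
  have int: "integrable F (\<lambda>x. ln (1 - \<nu> / a * x))"
  proof (rule integrable_unit_distribution[OF F])
    show "continuous_on {0..1} (\<lambda>x. ln (1 - \<nu> / a * x))"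
      using pos \<open>0 < a\<close>
      by (intro continuous_on_ln continuous_intros) (metis less_irrefl)+
  qed measurable
  have "AE x in F. ln (1 - \<nu> * (x - \<mu>)) = ln a + ln (1 - \<nu> / a * x)"
    using unit_distributionsD(4)[OF F] by eventually_elim (rule split)
  then have "(\<integral>x. ln (1 - \<nu> * (x - \<mu>)) \<partial>F) = (\<integral>x. ln a + ln (1 - \<nu> / a * x) \<partial>F)"
    by (intro integral_cong_AE) measurable
  also have "\<dots> = ln a + (\<integral>x. ln (1 - \<nu> / a * x) \<partial>F)"
    using int by (simp add: prob_space)
  finally show ?thesis unfolding a_def .
qed

text \<open>The multiplier is optimal for \<open>G\<close> and is used for \<open>F\<close> as well:
  the dual value of \<open>G\<close> bounds \<open>D_min G\<close> from above, that of
  \<open>F\<close> bounds \<open>D_min F\<close> from below, and the logarithmic integrals compare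
  the two. The case of no mass at 1 is that of a singleton class.\<close>

lemma D_min_node_set_strict:
  assumes "d \<ge> 1" and F: "F \<in> moment_class d M"
    and G: "G \<in> moment_class d M" "node_set d T" "AE x in G. x \<in> T"
    and \<mu>: "0 \<le> \<mu>" "M 1 < \<mu>" "\<mu> < 1"
  shows "D_min G \<mu> \<le> D_min F \<mu>" and "D_min G \<mu> = D_min F \<mu> \<Longrightarrow> F = G"
proof -
  note uF = moment_classD(1)[OF F] and uG = moment_classD(1)[OF G(1)]
  note T = node_setD[OF G(2)]
  have "D_min G \<mu> \<le> D_min F \<mu> \<and> (D_min G \<mu> = D_min F \<mu> \<longrightarrow> F = G)"
  proof (cases "measure G {1} = 0")
    case True
    then have "F = G" by (rule moment_class_singleton[OF assms(1) F G])
    then show ?thesis by simp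
  next
    case False
    then have "measure G {1} > 0" by (simp add: zero_less_measure_iff)
    moreover have "(\<integral>x. x \<partial>G) < \<mu>"
      using moment_classD(2)[OF G(1), of 1] \<open>d \<ge> 1\<close> \<mu>(2) by simp
    ultimately obtain \<nu> where \<nu>: "0 < \<nu>" "\<nu> * (1 - \<mu>) < 1"
        and mass: "(\<integral>x. 1 / (1 - \<nu> * (x - \<mu>)) \<partial>G) = 1"
        and mean: "(\<integral>x. x / (1 - \<nu> * (x - \<mu>)) \<partial>G) = \<mu>"
      using dual_optimum_exists[OF uG T(1-3) G(3)] \<mu> by blast
    have "0 \<le> \<nu>" using \<nu>(1) by simp
    define y where "y = \<nu> / (1 + \<nu> * \<mu>)"
    have "0 < 1 + \<nu> * \<mu>" using \<nu>(1) \<mu>(1) by (simp add: add_pos_nonneg)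
    \<comment> \<open>The bound \<open>y < 1\<close> is a restatement of
      \<open>\<nu> * (1 - \<mu>) < 1\<close>.\<close>
    then have y: "0 < y" "y < 1"
      using \<nu> by (auto simp: y_def algebra_simps)
    note ln_le = integral_ln_node_set[OF assms(1) F G y]
    note ln_eq = integral_ln_dual_density[OF _ \<mu>(1) \<open>0 \<le> \<nu>\<close> \<nu>(2), folded y_def]
    have upper: "D_min G \<mu> \<le> ereal (\<integral>x. ln (1 - \<nu> * (x - \<mu>)) \<partial>G)"
      using D_min_le[OF uG \<mu>(1) \<open>0 \<le> \<nu>\<close> \<nu>(2) mass] mean by simp
    have middle: "(\<integral>x. ln (1 - \<nu> * (x - \<mu>)) \<partial>G) \<le> (\<integral>x. ln (1 - \<nu> * (x - \<mu>)) \<partial>F)"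
      using ln_le(1) ln_eq[OF uF] ln_eq[OF uG] by simp
    have lower: "ereal (\<integral>x. ln (1 - \<nu> * (x - \<mu>)) \<partial>F) \<le> D_min F \<mu>"
      by (rule D_min_ge[OF uF \<mu>(1) \<open>0 \<le> \<nu>\<close> \<nu>(2)])
    have "F = G" if "D_min G \<mu> = D_min F \<mu>"
    proof -
      have "ereal (\<integral>x. ln (1 - \<nu> * (x - \<mu>)) \<partial>F) \<le> ereal (\<integral>x. ln (1 - \<nu> * (x - \<mu>)) \<partial>G)"
        using lower upper unfolding that by (rule order.trans)
      then have "(\<integral>x. ln (1 - \<nu> * (x - \<mu>)) \<partial>F) = (\<integral>x. ln (1 - \<nu> * (x - \<mu>)) \<partial>G)"
        using middle by simp
      then show ?thesis
        using ln_le(2) ln_eq[OF uF] ln_eq[OF uG] by simp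
    qed
    moreover have "D_min G \<mu> \<le> D_min F \<mu>"
      using upper middle lower by (meson ereal_less_eq(3) order.trans)
    ultimately show ?thesis by blast
  qed
  then show "D_min G \<mu> \<le> D_min F \<mu>" and "D_min G \<mu> = D_min F \<mu> \<Longrightarrow> F = G" by auto
qed

text \<open>Outside \<open>M 1 < \<mu> < 1\<close> all members of the class have the same value: 0
  if \<open>\<mu> \<le> M 1\<close>, and infinity if \<open>M 1 < \<mu> = 1\<close>.\<close>

lemma D_min_node_set_le:
  assumes "d \<ge> 1" and F: "F \<in> moment_class d M"
    and G: "G \<in> moment_class d M" "node_set d T" "AE x in G. x \<in> T"
    and \<mu>: "\<mu> \<in> {0..1}"
  shows "D_min G \<mu> \<le> D_min F \<mu>"
proof -
  note uF = moment_classD(1)[OF F] and uG = moment_classD(1)[OF G(1)]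
  have mean: "(\<integral>x. x \<partial>H) = M 1" if "H \<in> moment_class d M" for H
    using moment_classD(2)[OF that, of 1] \<open>d \<ge> 1\<close> by simp
  consider "\<mu> \<le> M 1" | "M 1 < \<mu>" "\<mu> = 1" | "M 1 < \<mu>" "\<mu> < 1"
    using \<mu> by fastforce
  then show ?thesis
  proof cases
    case 1
    then show ?thesis
      using D_min_eq_0[OF uF] D_min_eq_0[OF uG] mean[OF F] mean[OF G(1)] \<mu> by simp
  next
    case 2
    then show ?thesis
      using D_min_1_eq_infinity[OF uF] mean[OF F] by simp
  next
    case 3
    then show ?thesis
      using D_min_node_set_strict(1)[OF assms(1) F G] \<mu> by simp
  qed
qed

theorem theorem3:
  fixes d :: nat and \<mu> :: real and M :: "nat \<Rightarrow> real"
  assumes "d \<ge> 1"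
    and "\<mu> \<in> {0..1}"
    and "moment_class d M \<noteq> {}"
  shows "\<exists>Fbar.
    optimal_solution d M \<mu> Fbar \<and>
    (M 1 < \<mu> \<and> \<mu> < 1 \<longrightarrow> (\<forall>F. optimal_solution d M \<mu> F \<longrightarrow> F = Fbar)) \<and>
    (\<forall>F \<in> unit_distributions.
      F = Fbar \<longleftrightarrow>
      (\<exists>f x. moment_representation d M f x \<and> F = point_mixture (num_points d) f x))"
proof -
  obtain F where "F \<in> moment_class d M" using assms(3) by blast
  then obtain T g where "node_set d T" "\<forall>t\<in>T. 0 \<le> g t"
      "\<forall>m\<le>d. (\<Sum>t\<in>T. g t * t ^ m) = (M(0 := 1)) m"
    using quadrature_exists by blast
  then obtain f x where rep: "moment_representation d M f x"
    using representation_of_node_set[of d T g M] by blast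
  define G where "G = point_mixture (num_points d) f x"
  note G = point_mixture_of_representation(1)[OF rep, folded G_def]
    node_set_of_representation[OF rep]
    point_mixture_of_representation(2)[OF rep, folded G_def]
  have le: "D_min G \<mu> \<le> D_min F \<mu>" if "F \<in> moment_class d M" for F
    using D_min_node_set_le[OF assms(1) that G assms(2)] .
  have val: "D_min_moments d M \<mu> = D_min G \<mu>"
    unfolding D_min_moments_def using G(1) le by (intro antisym INF_lower INF_greatest)
  \<comment> \<open>Uniqueness is drawn from the range of \<open>\<mu>\<close> where
    \<open>D_min\<close> separates members; elsewhere it is constant on the class, so every member
    is optimal.\<close>
  have "F = G" if "M 1 < \<mu>" "\<mu> < 1" "optimal_solution d M \<mu> F" for F
  proof -
    have "F \<in> moment_class d M" "D_min G \<mu> = D_min F \<mu>"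
      using that(3) val by (auto simp: optimal_solution_def)
    then show ?thesis
      using D_min_node_set_strict(2)[OF assms(1) _ G] that assms(2) by simp
  qed
  moreover have "F = G \<longleftrightarrow>
      (\<exists>f x. moment_representation d M f x \<and> F = point_mixture (num_points d) f x)" for F
  proof
    assume "F = G"
    then show "\<exists>f x. moment_representation d M f x \<and> F = point_mixture (num_points d) f x"
      using rep by (auto simp: G_def)
  next
    assume "\<exists>f x. moment_representation d M f x \<and> F = point_mixture (num_points d) f x"
    then obtain f' x' where rep': "moment_representation d M f' x'"
        and F: "F = point_mixture (num_points d) f' x'"
      by blast
    \<comment> \<open>Any other representation also gives a member supported on a node set, and such
      a member is determined by the moments.\<close>
    show "F = G"
      unfolding F
      by (rule node_set_supported_unique[OF assms(1)
            point_mixture_of_representation(1)[OF rep'] node_set_of_representation[OF rep']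
            point_mixture_of_representation(2)[OF rep'] G])
  qed
  moreover have "optimal_solution d M \<mu> G"
    using G(1) val by (simp add: optimal_solution_def)
  ultimately show ?thesis by blast
qed

end
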